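(* Let $0<s\le 1$. Let $\beta>1$ and let $(\beta_n)_{n=1}^\infty$ be any sequence of real numbers with $1<\beta_n<\beta$ for all $n$ such that $\beta_n\to\beta$ as $n\to\infty$. Assume that $E\subset S_\beta$ and that $\pi_{\beta_n}(E\cap S_{\beta_n})$ is in the class $\mathcal{G}^s$ for all $n$. If $F\subset[0,1]$ is a $G_\delta$ set such that $F\supset\pi_\beta(E)$, then $F$ is also in the class $\mathcal{G}^s$.
   Context: For $\beta>1$ let $f_\beta(x)=\beta x \pmod 1$ and, for $x\in[0,1]$, let $d(x,\beta)=(d(x,\beta)_n)_{n=0}^\infty$ with $d(x,\beta)_n=[\beta f_\beta^n(x)]$, where $[\cdot]$ is the integer part. The $\beta$-shift $S_\beta$ is the closure, in the product topology on sequences of non-negative integer digits, of $\{d(x,\beta): x\in[0,1)\}$. One has $S_{\beta_1}\subseteq S_{\beta_2}$ if and only if $\beta_1\le\beta_2$. The map $\pi_\beta$ is defined on $S_\beta$ by $\pi_\beta((i_k)_{k=0}^\infty)=\sum_{k=0}^\infty i_k\beta^{-(k+1)}$; it takes values in $[0,1]$. For $0<s\le 1$, Falconer's class $\mathcal{G}^s(\mathbb{R})$ is the class of $G_\delta$ sets $F\subset\mathbb{R}$ such that $\dim_H\big(\bigcap_{i=1}^\infty g_i(F)\big)\ge s$ for all sequences $(g_i)_{i=1}^\infty$ of similarity transformations of $\mathbb{R}$ ($\dim_H$ is Hausdorff dimension). Here $\mathcal{G}^s$ denotes the restriction of this class to the unit interval: a set $F\subset[0,1]$ belongs to $\mathcal{G}^s$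 if $F=F'\cap[0,1]$ for some $F'\in\mathcal{G}^s(\mathbb{R})$. *)

theory Defs
  imports "HOL-Analysis.Analysis"
begin

section \<open>Hausdorff dimension\<close>

text \<open>
  Boundedness of the covering sets is required explicitly because \<^const>\<open>diameter\<close> is an
  unspecified real number for unbounded sets. The exponent \<open>t\<close> is only ever used for \<open>t > 0\<close>,
  so the convention \<open>0 powr 0 = 0\<close> plays no role.
\<close>

definition hausdorff_premeasure :: "real \<Rightarrow> real \<Rightarrow> 'a::metric_space set \<Rightarrow> ennreal" where
  "hausdorff_premeasure t \<delta> A =
     (INF U \<in> {U :: nat \<Rightarrow> 'a set. A \<subseteq> (\<Union>i. U i) \<and> (\<forall>i. bounded (U i) \<and> diameter (U i) \<le> \<delta>)}.
        \<Sum>i. ennreal (diameter (U i) powr t))"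

definition hausdorff_measure :: "real \<Rightarrow> 'a::metric_space set \<Rightarrow> ennreal" where
  "hausdorff_measure t A = (SUP \<delta> \<in> {0<..}. hausdorff_premeasure t \<delta> A)"

text \<open>The infimum of the empty set is \<open>\<infinity>\<close>, and the empty set has dimension \<open>0\<close>.\<close>

definition hausdorff_dim :: "'a::metric_space set \<Rightarrow> ennreal" where
  "hausdorff_dim A = Inf {ennreal t | t. 0 < t \<and> hausdorff_measure t A = 0}"

section \<open>Falconer's classes\<close>

text \<open>On the real line every such map is of the form \<open>x \<mapsto> a * x + b\<close> with \<open>a \<noteq> 0\<close>;
  in particular it is a bijection.\<close>

definition similarity :: "('a::metric_space \<Rightarrow> 'a) \<Rightarrow> bool" where
  "similarity g \<longleftrightarrow> (\<exists>r>0. \<forall>x y. dist (g x) (g y) = r * dist x y)"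

definition falconer_class :: "real \<Rightarrow> real set set" where
  "falconer_class s =
     {F. gdelta_in euclidean F \<and>
         (\<forall>g :: nat \<Rightarrow> real \<Rightarrow> real. (\<forall>i. similarity (g i)) \<longrightarrow>
            ennreal s \<le> hausdorff_dim (\<Inter>i. g i ` F))}"

definition falconer_class_unit :: "real \<Rightarrow> real set set" where
  "falconer_class_unit s = {F. \<exists>F' \<in> falconer_class s. F = F' \<inter> {0..1}}"

section \<open>Beta-shifts\<close>

definition beta_map :: "real \<Rightarrow> real \<Rightarrow> real" where
  "beta_map \<beta> x = frac (\<beta> * x)"

definition beta_digits :: "real \<Rightarrow> real \<Rightarrow> nat \<Rightarrow> nat" where
  "beta_digits \<beta> x n = nat \<lfloor>\<beta> * (beta_map \<beta> ^^ n) x\<rfloor>"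

text \<open>The topology on \<^typ>\<open>nat \<Rightarrow> nat\<close> is the product of the discrete topologies.\<close>

definition beta_shift :: "real \<Rightarrow> (nat \<Rightarrow> nat) set" where
  "beta_shift \<beta> = closure (beta_digits \<beta> ` {0..<1})"

definition beta_proj :: "real \<Rightarrow> (nat \<Rightarrow> nat) \<Rightarrow> real" where
  "beta_proj \<beta> d = (\<Sum>k. real (d k) / \<beta> ^ (k + 1))"

end

theory Submission
  imports Defs
begin

text \<open>
  Membership in Falconer's class is a local property, measured by Hausdorff content, that is, by
  covers without mesh restriction.

  On the one hand, if \<open>F\<close> is in the class for \<open>s\<close> and \<open>t < s\<close>, then the part of \<open>F\<close> in an interval of
  length \<open>d\<close> has content at least \<open>d powr t\<close>, as much as the interval itself
  (\<open>falconer_class_content_ge\<close>). Otherwise a cheaper cover exists, and intersecting all copies of \<open>F\<close>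
  obtained by iterating the affine maps onto the covering intervals repeats the saving in every
  generation; the intersection becomes a null set.

  On the other hand, a \<open>G\<^sub>\<delta>\<close> set belongs to the class already if, for each \<open>t < s\<close>, its part in a
  short interval of length \<open>d\<close> has content at least \<open>c * d powr e\<close>, where \<open>e\<close> is any exponent below \<open>1\<close>
  (\<open>falconer_classI\<close>). The weak exponent suffices because content adds up over small pieces
  until it is limited by the size of the whole interval (\<open>dyadic_capacity_bootstrap\<close>). A flow through
  the tree of dyadic intervals makes this precise and yields nested compact sets inside any sequence of
  such open sets without losing mass (\<open>hausdorff_content_INT_pos\<close>).

  It remains to transfer a content estimate from base \<open>\<beta>s n\<close> to base \<open>\<beta>\<close>. The values of a digit sequence in
  the two bases are uniformly close, so for a given interval and large \<open>n\<close> the sequences with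
  \<open>\<beta>s n\<close>-value in its middle half have \<open>\<beta>\<close>-value in the interval. On the common part of the two shifts, the map from
  \<open>\<beta>\<close>-values to \<open>\<beta>s n\<close>-values is Hoelder continuous for every exponent \<open>\<theta> < 1\<close>, once \<open>\<beta>s n\<close> is close to \<open>\<beta>\<close>, with a
  constant depending on \<open>\<beta>\<close> and \<open>\<theta>\<close> but not on \<open>n\<close> (\<open>beta_proj_Holder\<close>). The uniformity is essential, because \<open>n\<close>
  depends on the interval; it is paid for by taking \<open>\<theta>\<close> below the natural exponent \<open>ln (\<beta>s n) / ln \<beta>\<close>, for which
  the gap between \<open>t\<close> and \<open>s\<close> leaves room. Thus contents with exponent \<open>t / \<theta> < s\<close> in base \<open>\<beta>s n\<close> bound
  contents with exponent \<open>t\<close> in base \<open>\<beta>\<close> from below. Finally, \<open>F\<close> together with the complement of the unit interval is a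
  set in the class on the line whose restriction is \<open>F\<close>.
\<close>

section \<open>Hausdorff content\<close>

text \<open>
  Covers of arbitrary mesh are admitted, so for \<open>t \<le> 1\<close> an interval on the line has finite content,
  a power of its length, whereas its Hausdorff measure is infinite for \<open>t < 1\<close>. For \<open>t > 0\<close> the
  two have the same null sets.
\<close>

definition hausdorff_content :: "real \<Rightarrow> 'a::metric_space set \<Rightarrow> ennreal" where
  "hausdorff_content t A =
     (INF U \<in> {U :: nat \<Rightarrow> 'a set. A \<subseteq> (\<Union>i. U i) \<and> (\<forall>i. bounded (U i))}.
        \<Sum>i. ennreal (diameter (U i) powr t))"

lemma hausdorff_content_le_cover:
  assumes "A \<subseteq> (\<Union>i. U i)" and "\<And>i::nat. bounded (U i)"
  shows "hausdorff_content t A \<le> (\<Sum>i. ennreal (diameter (U i) powr t))"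
  unfolding hausdorff_content_def by (rule INF_lower) (use assms in auto)

lemma hausdorff_content_lessE:
  assumes "hausdorff_content t A < c"
  obtains U :: "nat \<Rightarrow> 'a::metric_space set"
  where "A \<subseteq> (\<Union>i. U i)" and "\<And>i. bounded (U i)" and "(\<Sum>i. ennreal (diameter (U i) powr t)) < c"
  using assms unfolding hausdorff_content_def by (auto simp: INF_less_iff)

lemma hausdorff_content_mono:
  "A \<subseteq> B \<Longrightarrow> hausdorff_content t A \<le> hausdorff_content t B"
  unfolding hausdorff_content_def by (rule INF_superset_mono) auto

lemma hausdorff_content_UN_le:
  "hausdorff_content t (\<Union>n::nat. A n) \<le> (\<Sum>n. hausdorff_content t (A n))"
proof (rule ennreal_le_epsilon)
  fix e :: real
  assume fin: "(\<Sum>n. hausdorff_content t (A n)) < top" and e: "0 < e"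
  have "\<exists>U. A n \<subseteq> (\<Union>i. U i) \<and> (\<forall>i. bounded (U i)) \<and>
      (\<Sum>i. ennreal (diameter (U i) powr t)) \<le> hausdorff_content t (A n) + e * (1/2) ^ Suc n" for n
  proof -
    have "hausdorff_content t (A n) \<noteq> top"
      using fin ennreal_suminf_lessD by (metis less_irrefl)
    then have "hausdorff_content t (A n) < hausdorff_content t (A n) + e * (1/2) ^ Suc n"
      using e ennreal_add_left_cancel_less[of "hausdorff_content t (A n)" 0 "ennreal (e * (1/2) ^ Suc n)"]
      by auto
    from hausdorff_content_lessE[OF this] show ?thesis
      by (metis less_imp_le)
  qed
  then obtain U where U: "\<And>n. A n \<subseteq> (\<Union>i. U n i)" "\<And>n i. bounded (U n i)"
      "\<And>n. (\<Sum>i. ennreal (diameter (U n i) powr t)) \<le> hausdorff_content t (A n) + e * (1/2) ^ Suc n"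
    by metis
  define V where "V = (\<lambda>k. case_prod U (prod_decode k))"
  have "(\<Union>n. A n) \<subseteq> (\<Union>k. V k)"
  proof
    fix x assume "x \<in> (\<Union>n. A n)"
    then obtain n i where "x \<in> U n i" using U(1) by blast
    then show "x \<in> (\<Union>k. V k)"
      unfolding V_def by (intro UN_I[of "prod_encode (n, i)"]) auto
  qed
  moreover have "\<And>k. bounded (V k)"
    unfolding V_def using U(2) by (auto split: prod.split)
  ultimately have "hausdorff_content t (\<Union>n. A n) \<le> (\<Sum>k. ennreal (diameter (V k) powr t))"
    by (rule hausdorff_content_le_cover)
  also have "\<dots> = (\<Sum>k. (\<lambda>(n, i). ennreal (diameter (U n i) powr t)) (prod_decode k))"
    unfolding V_def by (intro suminf_cong) (auto split: prod.split)
  also have "\<dots> = (\<Sum>n. \<Sum>i. ennreal (diameter (U n i) powr t))"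
    by (rule suminf_ennreal_2dimen) auto
  also have "\<dots> \<le> (\<Sum>n. hausdorff_content t (A n) + e * (1/2) ^ Suc n)"
    by (intro suminf_le U(3)) auto
  also have "... = (\<Sum>n. hausdorff_content t (A n)) + (\<Sum>n. ennreal e * ennreal ((1/2) ^ Suc n))"
    using e by (subst suminf_add[symmetric])
       (auto simp del: ennreal_suminf_cmult simp add: ennreal_mult[symmetric])
  also have "\<dots> = (\<Sum>n. hausdorff_content t (A n)) + e"
    unfolding ennreal_suminf_cmult
    by (subst suminf_ennreal_eq[OF zero_le_power power_half_series]) auto
  finally show "hausdorff_content t (\<Union>n. A n) \<le> (\<Sum>n. hausdorff_content t (A n)) + e" .
qed

lemma diameter_le_Holder:
  fixes p :: "'i \<Rightarrow> 'a::metric_space" and q :: "'i \<Rightarrow> 'b::real_normed_vector"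
  assumes "\<And>x y. x \<in> T \<Longrightarrow> y \<in> T \<Longrightarrow> dist (q x) (q y) \<le> C * dist (p x) (p y) powr \<theta>"
    and "0 \<le> C" "0 < \<theta>" "bounded U"
  shows "bounded (q ` {x\<in>T. p x \<in> U}) \<and> diameter (q ` {x\<in>T. p x \<in> U}) \<le> C * diameter U powr \<theta>"
proof -
  have *: "dist u v \<le> C * diameter U powr \<theta>"
    if "u \<in> q ` {x\<in>T. p x \<in> U}" "v \<in> q ` {x\<in>T. p x \<in> U}" for u v
  proof -
    from that obtain x y where xy: "x \<in> T" "p x \<in> U" "u = q x" "y \<in> T" "p y \<in> U" "v = q y" by blast
    have "dist u v \<le> C * dist (p x) (p y) powr \<theta>" using assms xy by blast
    also have "\<dots> \<le> C * diameter U powr \<theta>"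
      using assms xy by (intro mult_left_mono powr_mono2 diameter_bounded_bound) auto
    finally show ?thesis .
  qed
  have "bounded (q ` {x\<in>T. p x \<in> U})"
    unfolding bounded_two_points using * by blast
  moreover have "diameter (q ` {x\<in>T. p x \<in> U}) \<le> C * diameter U powr \<theta>"
    by (rule diameter_le) (use assms * in \<open>auto simp: dist_norm\<close>)
  ultimately show ?thesis by blast
qed

text \<open>
  The map in question is \<open>p x \<mapsto> q x\<close>. Giving it by two parametrisations over one index set
  saves naming its domain and inverse: later \<open>p\<close> and \<open>q\<close> are the values of one digit sequence
  in two bases.
\<close>

lemma hausdorff_content_Holder:
  fixes p :: "'i \<Rightarrow> 'a::metric_space" and q :: "'i \<Rightarrow> 'b::real_normed_vector"
  assumes "\<And>x y. x \<in> T \<Longrightarrow> y \<in> T \<Longrightarrow> dist (q x) (q y) \<le> C * dist (p x) (p y) powr \<theta>"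
    and "0 < C" "0 < \<theta>" "0 < t"
  shows "hausdorff_content t (q ` T) \<le> ennreal (C powr t) * hausdorff_content (\<theta> * t) (p ` T)"
proof -
  have *: "hausdorff_content t (q ` T) \<le> ennreal (C powr t) * (\<Sum>i. ennreal (diameter (U i) powr (\<theta> * t)))"
    if U: "p ` T \<subseteq> (\<Union>i. U i)" "\<And>i. bounded (U i)" for U :: "nat \<Rightarrow> 'a set"
  proof -
    define V where "V i = q ` {x\<in>T. p x \<in> U i}" for i
    have V: "bounded (V i) \<and> diameter (V i) \<le> C * diameter (U i) powr \<theta>" for i
      unfolding V_def
      by (rule diameter_le_Holder[where p=p]) (fact assms(1), use assms U(2) in simp_all)
    have "q ` T \<subseteq> (\<Union>i. V i)" unfolding V_def using U(1) by blast
    then have "hausdorff_content t (q ` T) \<le> (\<Sum>i. ennreal (diameter (V i) powr t))"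
      using V by (intro hausdorff_content_le_cover) auto
    also have "\<dots> \<le> (\<Sum>i. ennreal (C powr t) * ennreal (diameter (U i) powr (\<theta> * t)))"
    proof (intro suminf_le)
      fix i
      have "diameter (V i) powr t \<le> (C * diameter (U i) powr \<theta>) powr t"
        using V[of i] assms by (intro powr_mono2) (auto intro: diameter_ge_0)
      also have "\<dots> = C powr t * diameter (U i) powr (\<theta> * t)"
        using assms by (simp add: powr_mult powr_powr)
      finally show "ennreal (diameter (V i) powr t) \<le> ennreal (C powr t) * ennreal (diameter (U i) powr (\<theta> * t))"
        by (simp add: ennreal_mult'[symmetric] ennreal_leI)
    qed auto
    finally show ?thesis by simp
  qed
  have one: "ennreal (1 / C powr t) * ennreal (C powr t) = 1"
    using \<open>0 < C\<close> by (simp flip: ennreal_mult')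
  have "ennreal (1 / C powr t) * hausdorff_content t (q ` T) \<le> hausdorff_content (\<theta> * t) (p ` T)"
    unfolding hausdorff_content_def[of "\<theta> * t"]
  proof (rule INF_greatest, clarify)
    fix U :: "nat \<Rightarrow> 'a set"
    assume U: "p ` T \<subseteq> (\<Union>i. U i)" "\<forall>i. bounded (U i)"
    have "ennreal (1 / C powr t) * hausdorff_content t (q ` T)
        \<le> ennreal (1 / C powr t) * (ennreal (C powr t) * (\<Sum>i. ennreal (diameter (U i) powr (\<theta> * t))))"
      by (intro mult_left_mono *) (use U in auto)
    also have "\<dots> = (\<Sum>i. ennreal (diameter (U i) powr (\<theta> * t)))"
      by (simp only: mult.assoc[symmetric] one mult_1)
    finally show "ennreal (1 / C powr t) * hausdorff_content t (q ` T)
        \<le> (\<Sum>i. ennreal (diameter (U i) powr (\<theta> * t)))" .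
  qed
  then have "ennreal (C powr t) * (ennreal (1 / C powr t) * hausdorff_content t (q ` T))
      \<le> ennreal (C powr t) * hausdorff_content (\<theta> * t) (p ` T)"
    by (intro mult_left_mono) auto
  then show ?thesis
    by (simp only: mult.assoc[symmetric] mult.commute[of "ennreal (C powr t)"] one mult_1)
qed

text \<open>
  A cover whose sum is below \<open>\<delta> powr t\<close> consists of sets of diameter at most \<open>\<delta>\<close>, so the mesh
  restriction in the Hausdorff measure costs nothing.
\<close>

lemma hausdorff_content_0_imp_measure_0:
  assumes "hausdorff_content t A = 0" "0 < t"
  shows "hausdorff_measure t A = 0"
proof -
  have "hausdorff_premeasure t \<delta> A = 0" if "0 < \<delta>" for \<delta>
  proof (rule antisym[OF ennreal_le_epsilon])
    fix e :: real assume e: "0 < e"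
    have "hausdorff_content t A < ennreal (min e (\<delta> powr t))"
      using assms e that by simp
    then obtain U :: "nat \<Rightarrow> 'a set" where U: "A \<subseteq> (\<Union>i. U i)" "\<And>i. bounded (U i)"
      and s: "(\<Sum>i. ennreal (diameter (U i) powr t)) < ennreal (min e (\<delta> powr t))"
      by (rule hausdorff_content_lessE) blast
    have "diameter (U i) \<le> \<delta>" for i
    proof -
      have "ennreal (diameter (U i) powr t) \<le> (\<Sum>i. ennreal (diameter (U i) powr t))"
        by (meson ennreal_suminf_lessD linorder_not_le order_less_irrefl)
      also note s
      finally have "diameter (U i) powr t < \<delta> powr t" by (simp add: ennreal_less_iff)
      then show ?thesis using assms that by (metis less_imp_le linorder_not_less powr_mono2)
    qed
    then have "hausdorff_premeasure t \<delta> A \<le> (\<Sum>i. ennreal (diameter (U i) powr t))"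
      unfolding hausdorff_premeasure_def using U by (intro INF_lower) auto
    also have "\<dots> \<le> 0 + ennreal e" using order_trans[OF less_imp_le[OF s] ennreal_leI[OF min.cobounded1]] by simp
    finally show "hausdorff_premeasure t \<delta> A \<le> 0 + ennreal e" .
  qed auto
  then show ?thesis unfolding hausdorff_measure_def by (simp add: SUP_eq_const)
qed

lemma hausdorff_content_le_measure:
  "hausdorff_content t A \<le> hausdorff_measure t A"
proof -
  have "hausdorff_content t A \<le> hausdorff_premeasure t 1 A"
    unfolding hausdorff_premeasure_def hausdorff_content_def by (rule INF_superset_mono) auto
  also have "\<dots> \<le> hausdorff_measure t A"
    unfolding hausdorff_measure_def by (rule SUP_upper) auto
  finally show ?thesis .
qed

section \<open>Content of sets in Falconer's class\<close>

text \<open>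
  Each covering set is enlarged by its share \<open>\<eta> / 2 ^ Suc i\<close> of the slack in the strict inequality.
  Openness serves compactness arguments; nondegeneracy makes each interval the image of any
  other one under a similarity.
\<close>

lemma hausdorff_content_less_open_cover:
  fixes A :: "real set"
  assumes "hausdorff_content t A < ennreal c" and t: "0 < t"
  obtains p q :: "nat \<Rightarrow> real"
  where "\<And>i. p i < q i" and "A \<subseteq> (\<Union>i. {p i<..<q i})"
    and "(\<Sum>i. ennreal ((q i - p i) powr t)) < ennreal c"
proof -
  obtain U :: "nat \<Rightarrow> real set" where U: "A \<subseteq> (\<Union>i. U i)" "\<And>i. bounded (U i)"
    and less: "(\<Sum>i. ennreal (diameter (U i) powr t)) < ennreal c"
    using hausdorff_content_lessE[OF assms(1)] by blast
  obtain \<sigma> where \<sigma>: "0 \<le> \<sigma>" "(\<Sum>i. ennreal (diameter (U i) powr t)) = ennreal \<sigma>"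
    using less by (metis ennreal_cases less_top_ennreal order_less_trans top.not_eq_extremum ennreal_less_top)
  then have "\<sigma> < c" using less by (simp add: ennreal_less_iff)
  define \<eta> where "\<eta> = (c - \<sigma>) / 2"
  have \<eta>: "0 < \<eta>" "\<sigma> + \<eta> < c" using \<open>\<sigma> < c\<close> by (auto simp: \<eta>_def field_simps)
  define d where "d i = (diameter (U i) powr t + \<eta> * (1/2) ^ Suc i) powr (1 / t)" for i
  have d_powr: "d i powr t = diameter (U i) powr t + \<eta> * (1/2) ^ Suc i" for i
    unfolding d_def using t \<eta> by (simp add: powr_powr)
  have d_gt: "diameter (U i) < d i" for i
  proof (rule ccontr)
    assume "\<not> diameter (U i) < d i"
    then have "d i powr t \<le> diameter (U i) powr t" using t by (intro powr_mono2) (auto simp: d_def)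
    then have "\<eta> * (1/2) ^ Suc i \<le> 0" by (simp add: d_powr)
    moreover have "0 < \<eta> * (1/2) ^ Suc i" using \<eta> by simp
    ultimately show False by linarith
  qed
  define p where "p i = Inf (U i) - (d i - diameter (U i)) / 2" for i
  define q where "q i = p i + d i" for i
  have d_pos: "0 < d i" for i using d_gt[of i] diameter_ge_0[OF U(2), of i] by linarith
  have "U i \<subseteq> {p i<..<q i}" for i
  proof
    fix x assume x: "x \<in> U i"
    have "Inf (U i) \<le> x" using x U(2) by (intro cInf_lower bounded_imp_bdd_below) auto
    moreover have "x - diameter (U i) \<le> Inf (U i)"
    proof (rule cInf_greatest)
      fix y assume "y \<in> U i"
      then show "x - diameter (U i) \<le> y"
        using diameter_bounded_bound[OF U(2) x, of y] by (simp add: dist_real_def)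
    qed (use x in auto)
    ultimately show "x \<in> {p i<..<q i}"
      using d_gt[of i] unfolding q_def p_def by (auto simp: field_simps)
  qed
  then have "A \<subseteq> (\<Union>i. {p i<..<q i})" by (intro order_trans[OF U(1)] UN_mono) auto
  moreover have "p i < q i" for i using d_pos by (simp add: q_def)
  moreover have "(\<Sum>i. ennreal ((q i - p i) powr t)) < ennreal c"
  proof -
    have "(\<Sum>i. ennreal ((q i - p i) powr t))
        = (\<Sum>i. ennreal (diameter (U i) powr t) + ennreal \<eta> * ennreal ((1/2) ^ Suc i))"
    proof (intro suminf_cong)
      fix i
      have "ennreal (\<eta> * (1/2) ^ Suc i) = ennreal \<eta> * ennreal ((1/2) ^ Suc i)"
        using \<eta> by (intro ennreal_mult) auto
      then show "ennreal ((q i - p i) powr t)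
          = ennreal (diameter (U i) powr t) + ennreal \<eta> * ennreal ((1/2) ^ Suc i)"
        using \<eta> by (simp add: q_def d_powr del: power_Suc)
    qed
    also have "\<dots> = ennreal \<sigma> + (\<Sum>i. ennreal \<eta> * ennreal ((1/2) ^ Suc i))"
      by (subst suminf_add[symmetric]) (simp_all add: \<sigma> del: ennreal_suminf_cmult power_Suc)
    also have "\<dots> = ennreal \<sigma> + ennreal \<eta>"
      unfolding ennreal_suminf_cmult
      by (subst suminf_ennreal_eq[OF zero_le_power power_half_series]) auto
    also have "\<dots> < ennreal c" using \<sigma> \<eta> by (simp add: ennreal_less_iff flip: ennreal_plus)
    finally show ?thesis .
  qed
  ultimately show ?thesis using that by blast
qed

lemma hausdorff_content_affine_le:
  fixes A :: "real set"
  assumes "r \<noteq> 0" "0 < t"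
  shows "hausdorff_content t ((\<lambda>x. r * x + c) ` A) \<le> ennreal (\<bar>r\<bar> powr t) * hausdorff_content t A"
  using hausdorff_content_Holder[of A "\<lambda>x. r * x + c" "\<bar>r\<bar>" "\<lambda>x. x" 1 t] assms
  by (simp add: dist_real_def abs_mult[symmetric] right_diff_distrib)

lemma similarity_affine: "r \<noteq> 0 \<Longrightarrow> similarity (\<lambda>x::real. r * x + c)"
  unfolding similarity_def
  by (intro exI[of _ "\<bar>r\<bar>"]) (simp add: dist_real_def abs_mult[symmetric] right_diff_distrib)

lemma similarity_comp:
  assumes "similarity f" "similarity g"
  shows "similarity (f \<circ> g)"
proof -
  obtain r r' where "0 < r" "\<And>x y. dist (f x) (f y) = r * dist x y"
    and "0 < r'" "\<And>x y. dist (g x) (g y) = r' * dist x y"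
    using assms unfolding similarity_def by blast
  then show ?thesis unfolding similarity_def by (intro exI[of _ "r * r'"]) (simp add: mult.assoc)
qed

primrec compose_word :: "(nat \<Rightarrow> 'a \<Rightarrow> 'a) \<Rightarrow> nat list \<Rightarrow> 'a \<Rightarrow> 'a" where
  "compose_word f [] = id"
| "compose_word f (i # w) = f i \<circ> compose_word f w"

lemma similarity_id: "similarity id"
  unfolding similarity_def by (intro exI[of _ 1]) auto

lemma similarity_compose_word: "(\<And>i. similarity (f i)) \<Longrightarrow> similarity (compose_word f w)"
  by (induction w) (auto simp: similarity_id similarity_comp simp flip: id_def)

lemma hausdorff_dim_le: "hausdorff_measure t A = 0 \<Longrightarrow> 0 < t \<Longrightarrow> hausdorff_dim A \<le> ennreal t"
  unfolding hausdorff_dim_def by (intro Inf_lower) auto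

text \<open>
  If \<open>F\<close> had a cheaper cover of its part in \<open>(a, b)\<close> by intervals \<open>(p i, q i)\<close>, that saving could be
  repeated inside every \<open>(p i, q i)\<close>, because rescaled copies of \<open>F\<close> may be intersected as well.
  Instead of following covers through all generations, let \<open>G\<close> be the intersection of all
  copies of \<open>F\<close> under compositions of the affine maps \<open>f i\<close> from \<open>(a, b)\<close> onto \<open>(p i, q i)\<close>. Then
  \<open>G \<inter> (a, b)\<close> is contained in the union of its own images under the \<open>f i\<close>, whence its content \<open>h\<close>
  satisfies \<open>h \<le> \<lambda> * h\<close> with \<open>\<lambda> < 1\<close> the sum of the \<open>t\<close>-th powers of the ratios.
  So \<open>h = 0\<close>, and a countable intersection of copies of \<open>F\<close> has dimension at most \<open>t < s\<close>.
\<close>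

lemma falconer_class_content_ge:
  assumes F: "F \<in> falconer_class s" and t: "0 < t" "t < s" and ab: "a < b"
  shows "ennreal ((b - a) powr t) \<le> hausdorff_content t (F \<inter> {a<..<b})"
proof (rule ccontr)
  assume "\<not> ?thesis"
  then have "hausdorff_content t (F \<inter> {a<..<b}) < ennreal ((b - a) powr t)" by simp
  from hausdorff_content_less_open_cover[OF this t(1)]
  obtain p q :: "nat \<Rightarrow> real" where pq: "\<And>i. p i < q i" "F \<inter> {a<..<b} \<subseteq> (\<Union>i. {p i<..<q i})"
    and sum: "(\<Sum>i. ennreal ((q i - p i) powr t)) < ennreal ((b - a) powr t)"
    by blast
  define r where "r i = (q i - p i) / (b - a)" for i
  have r: "0 < r i" for i using pq(1) ab by (simp add: r_def)
  define f where "f i x = r i * x + (p i - r i * a)" for i x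
  define G where "G = (\<Inter>w. compose_word f w ` F)"
  define h where "h = hausdorff_content t (G \<inter> {a<..<b})"
  have inj_f: "f i x = f i y \<longleftrightarrow> x = y" for i x y using r[of i] by (simp add: f_def)
  have f_onto: "\<exists>y\<in>{a<..<b}. x = f i y" if "x \<in> {p i<..<q i}" for x i
  proof (intro bexI)
    show "x = f i (a + (x - p i) / r i)" using r[of i] by (simp add: f_def field_simps)
    have "(x - p i) / r i < b - a" 
    proof -
      have "(b - a) * r i = q i - p i" using ab by (simp add: r_def)
      then show ?thesis using that r[of i] by (simp add: pos_divide_less_eq)
    qed
    then show "a + (x - p i) / r i \<in> {a<..<b}" using that r[of i] by auto
  qed
  have "G \<subseteq> F"
  proof
    fix x assume "x \<in> G"
    then have "x \<in> compose_word f [] ` F" unfolding G_def by blast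
    then show "x \<in> F" by simp
  qed
  \<comment> \<open>prepending a letter to a word gives a word, so pulling \<open>G\<close> back along \<open>f i\<close> stays in \<open>G\<close>\<close>
  have "G \<inter> {a<..<b} \<subseteq> (\<Union>i. f i ` (G \<inter> {a<..<b}))"
  proof
    fix x assume x: "x \<in> G \<inter> {a<..<b}"
    then have "x \<in> F" using \<open>G \<subseteq> F\<close> by blast
    then obtain i y where y: "y \<in> {a<..<b}" "x = f i y" using pq(2) x f_onto by blast
    have "y \<in> G" unfolding G_def
    proof
      fix w :: "nat list"
      have "x \<in> compose_word f (i # w) ` F" using x unfolding G_def by blast
      then show "y \<in> compose_word f w ` F" using y inj_f by auto
    qed
    then show "x \<in> (\<Union>i. f i ` (G \<inter> {a<..<b}))" using y by blast
  qed
  then have "h \<le> hausdorff_content t (\<Union>i. f i ` (G \<inter> {a<..<b}))"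
    unfolding h_def by (rule hausdorff_content_mono)
  also have "\<dots> \<le> (\<Sum>i. hausdorff_content t (f i ` (G \<inter> {a<..<b})))"
    by (rule hausdorff_content_UN_le)
  also have "\<dots> \<le> (\<Sum>i. ennreal (r i powr t) * h)"
  proof (intro suminf_le)
    fix i
    show "hausdorff_content t (f i ` (G \<inter> {a<..<b})) \<le> ennreal (r i powr t) * h"
      using hausdorff_content_affine_le[of "r i" t "p i - r i * a" "G \<inter> {a<..<b}"] r[of i] t
      unfolding f_def h_def by simp
  qed auto
  also have "\<dots> = (\<Sum>i. ennreal (r i powr t)) * h" by simp
  finally have h_le: "h \<le> (\<Sum>i. ennreal (r i powr t)) * h" .
  have "(\<Sum>i. ennreal (r i powr t)) = (\<Sum>i. ennreal (1 / (b - a) powr t) * ennreal ((q i - p i) powr t))"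
    using pq(1) ab by (intro suminf_cong) (simp add: r_def powr_divide less_imp_le flip: ennreal_mult)
  also have "\<dots> = ennreal (1 / (b - a) powr t) * (\<Sum>i. ennreal ((q i - p i) powr t))" by simp
  also have "\<dots> < ennreal (1 / (b - a) powr t) * ennreal ((b - a) powr t)"
    using sum ab by (intro ennreal_mult_strict_left_mono) auto
  also have "\<dots> = 1" using ab by (simp flip: ennreal_mult)
  finally have lt1: "(\<Sum>i. ennreal (r i powr t)) < 1" .
  have "h \<le> hausdorff_content t (F \<inter> {a<..<b})"
    unfolding h_def using \<open>G \<subseteq> F\<close> by (intro hausdorff_content_mono) blast
  also have "\<dots> < ennreal ((b - a) powr t)" by fact
  finally have "h \<noteq> top" by auto
  have "h = 0"
  proof -
    obtain l where l: "0 \<le> l" "(\<Sum>i. ennreal (r i powr t)) = ennreal l"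
      using lt1 by (metis ennreal_cases not_less_iff_gr_or_eq ennreal_one_less_top order_less_trans)
    obtain x where x: "0 \<le> x" "h = ennreal x" using \<open>h \<noteq> top\<close> by (metis ennreal_cases)
    have "l < 1" using lt1 l by (metis ennreal_1 ennreal_less_iff)
    have "x \<le> l * x" using h_le l x by (simp flip: ennreal_mult)
    then have "(1 - l) * x \<le> 0" by (simp add: algebra_simps)
    then show ?thesis using \<open>l < 1\<close> x by (simp add: mult_le_0_iff)
  qed
  \<comment> \<open>translates of \<open>(a, b)\<close> by multiples of half its length cover the line\<close>
  define T where "T z x = x + of_int z * ((b - a) / 2)" for z :: int and x :: real
  define g where "g n = (case (from_nat n :: int \<times> nat list) of (z, w) \<Rightarrow> T z \<circ> compose_word f w)" for n
  have sim: "similarity (g n)" for n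
  proof -
    have "similarity (T z)" for z
      using similarity_affine[of 1 "of_int z * ((b - a) / 2)"] by (simp add: T_def[abs_def])
    moreover have "similarity (compose_word f w)" for w
      using r by (intro similarity_compose_word) (auto simp: f_def[abs_def] less_imp_neq[symmetric] intro!: similarity_affine)
    ultimately show ?thesis by (auto simp: g_def split: prod.split intro: similarity_comp)
  qed
  have "(\<Inter>n. g n ` F) \<subseteq> (\<Union>n. T (from_nat n) ` (G \<inter> {a<..<b}))"
  proof
    fix x assume x: "x \<in> (\<Inter>n. g n ` F)"
    define z where "z = \<lceil>(x - a) / ((b - a) / 2)\<rceil> - 1"
    define y where "y = x - of_int z * ((b - a) / 2)"
    have "of_int z < (x - a) / ((b - a) / 2)" "(x - a) / ((b - a) / 2) \<le> of_int z + 1"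
      unfolding z_def by linarith+
    then have "y \<in> {a<..<b}" using ab by (simp add: y_def field_simps)
    moreover have "y \<in> G" unfolding G_def
    proof
      fix w :: "nat list"
      have "x \<in> g (to_nat (z, w)) ` F" using x by blast
      then show "y \<in> compose_word f w ` F" by (auto simp: g_def T_def y_def)
    qed
    moreover have "x = T (from_nat (to_nat z)) y" by (simp add: T_def y_def)
    ultimately show "x \<in> (\<Union>n. T (from_nat n) ` (G \<inter> {a<..<b}))" by blast
  qed
  then have "hausdorff_content t (\<Inter>n. g n ` F) \<le> hausdorff_content t (\<Union>n. T (from_nat n) ` (G \<inter> {a<..<b}))"
    by (rule hausdorff_content_mono)
  also have "\<dots> \<le> (\<Sum>n. hausdorff_content t (T (from_nat n) ` (G \<inter> {a<..<b})))"
    by (rule hausdorff_content_UN_le)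
  also have "\<dots> = 0"
  proof -
    have "hausdorff_content t (T z ` (G \<inter> {a<..<b})) = 0" for z
      using hausdorff_content_affine_le[of 1 t "of_int z * ((b - a) / 2)" "G \<inter> {a<..<b}"] t \<open>h = 0\<close>
      unfolding T_def h_def by simp
    then show ?thesis by simp
  qed
  finally have "hausdorff_measure t (\<Inter>n. g n ` F) = 0"
    using t by (intro hausdorff_content_0_imp_measure_0) auto
  then have "hausdorff_dim (\<Inter>n. g n ` F) \<le> ennreal t" using t(1) by (rule hausdorff_dim_le)
  moreover have "ennreal s \<le> hausdorff_dim (\<Inter>n. g n ` F)"
    using F sim unfolding falconer_class_def by blast
  ultimately have "ennreal s \<le> ennreal t" by order
  then show False using t by (simp add: ennreal_le_iff)
qed

section \<open>Flows through the tree of dyadic intervals\<close>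

text \<open>
  The interval \<open>[m / 2 ^ k, (m + 1) / 2 ^ k)\<close>.
\<close>

definition dyadic :: "nat \<Rightarrow> int \<Rightarrow> real set" where
  "dyadic k m = {x. \<lfloor>2 ^ k * x\<rfloor> = m}"

definition closed_dyadic :: "nat \<Rightarrow> int \<Rightarrow> real set" where
  "closed_dyadic k m = {of_int m / 2 ^ k .. (of_int m + 1) / 2 ^ k}"

abbreviation dyadic_weight :: "real \<Rightarrow> nat \<Rightarrow> real" where
  "dyadic_weight t k \<equiv> (1 / 2 ^ k) powr t"

text \<open>
  The dyadic intervals form a binary tree; let each \<open>J\<close> carry at most \<open>\<bar>J\<bar> powr t\<close> units of mass. The
  value below is the largest mass that can be sent from the interval \<open>(k, m)\<close> to those of its
  descendants \<open>n\<close> levels below whose closures lie in \<open>X\<close>. Such flows replace Frostman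
  measures, and weak duality replaces the mass distribution principle.
\<close>

primrec dyadic_flow :: "real \<Rightarrow> real set \<Rightarrow> nat \<Rightarrow> nat \<Rightarrow> int \<Rightarrow> real" where
  "dyadic_flow t X 0 k m = (if closed_dyadic k m \<subseteq> X then dyadic_weight t k else 0)"
| "dyadic_flow t X (Suc n) k m =
     min (dyadic_weight t k) (dyadic_flow t X n (Suc k) (2 * m) + dyadic_flow t X n (Suc k) (2 * m + 1))"

definition dyadic_capacity :: "real \<Rightarrow> real set \<Rightarrow> nat \<Rightarrow> int \<Rightarrow> real" where
  "dyadic_capacity t X k m = (SUP n. dyadic_flow t X n k m)"

lemma mem_dyadic_iff: "x \<in> dyadic k m \<longleftrightarrow> of_int m \<le> 2 ^ k * x \<and> 2 ^ k * x < of_int m + 1"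
  unfolding dyadic_def by (auto simp: floor_eq_iff)

lemma dyadic_subset_closed_dyadic: "dyadic k m \<subseteq> closed_dyadic k m"
  unfolding closed_dyadic_def by (auto simp: mem_dyadic_iff field_simps)

lemma left_endpoint_in_dyadic: "of_int m / 2 ^ k \<in> dyadic k m"
  by (simp add: mem_dyadic_iff)

lemma closed_dyadic_dist_le:
  assumes "x \<in> closed_dyadic k m" "y \<in> closed_dyadic k m"
  shows "\<bar>x - y\<bar> \<le> 1 / 2 ^ k"
  using assms unfolding closed_dyadic_def by (auto simp: abs_le_iff add_divide_distrib)

lemma bounded_dyadic: "bounded (dyadic k m)"
  by (rule bounded_subset[OF _ dyadic_subset_closed_dyadic]) (simp add: closed_dyadic_def)

lemma diameter_dyadic_le: "diameter (dyadic k m) \<le> 1 / 2 ^ k"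
proof (rule diameter_le)
  fix x y assume "x \<in> dyadic k m" "y \<in> dyadic k m"
  then have "x \<in> closed_dyadic k m" "y \<in> closed_dyadic k m"
    using dyadic_subset_closed_dyadic by blast+
  then show "norm (x - y) \<le> 1 / 2 ^ k" by (simp add: closed_dyadic_dist_le)
qed simp

lemma closed_dyadic_children:
  "closed_dyadic (Suc k) (2 * m) \<subseteq> closed_dyadic k m" "closed_dyadic (Suc k) (2 * m + 1) \<subseteq> closed_dyadic k m"
  unfolding closed_dyadic_def by (auto simp: field_simps)

lemma dyadic_split: "dyadic k m = dyadic (Suc k) (2 * m) \<union> dyadic (Suc k) (2 * m + 1)"
  unfolding dyadic_def by (auto; linarith)

lemma dyadic_weight_antimono: "0 \<le> t \<Longrightarrow> k \<le> l \<Longrightarrow> dyadic_weight t l \<le> dyadic_weight t k"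
  by (intro powr_mono2) (auto simp: field_simps power_increasing)

lemma dyadic_weight_le_twice:
  assumes "t \<le> 1"
  shows "dyadic_weight t k \<le> 2 * dyadic_weight t (Suc k)"
proof -
  have "dyadic_weight t k = (2 * (1 / 2 ^ Suc k)) powr t" by simp
  also have "\<dots> = 2 powr t * dyadic_weight t (Suc k)" by (subst powr_mult) auto
  also have "\<dots> \<le> 2 powr 1 * dyadic_weight t (Suc k)"
    using assms by (intro mult_right_mono powr_mono) auto
  finally show ?thesis by simp
qed

lemma dyadic_flow_nonneg: "0 \<le> dyadic_flow t X n k m"
  by (induction n arbitrary: k m) auto

lemma dyadic_flow_le: "dyadic_flow t X n k m \<le> dyadic_weight t k"
  by (cases n) auto

lemma dyadic_flow_transfer:
  assumes "\<And>j. m * 2 ^ n \<le> j \<Longrightarrow> j < (m + 1) * 2 ^ n \<Longrightarrow> closed_dyadic (k + n) j \<subseteq> X \<Longrightarrow> closed_dyadic (k + n) j \<subseteq> Y"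
  shows "dyadic_flow t X n k m \<le> dyadic_flow t Y n k m"
  using assms
proof (induction n arbitrary: k m)
  case 0
  then show ?case by auto
next
  case (Suc n)
  have "dyadic_flow t X n (Suc k) (2 * m) \<le> dyadic_flow t Y n (Suc k) (2 * m)"
    by (rule Suc.IH) (use Suc.prems in \<open>simp add: algebra_simps\<close>)
  moreover have "dyadic_flow t X n (Suc k) (2 * m + 1) \<le> dyadic_flow t Y n (Suc k) (2 * m + 1)"
    by (rule Suc.IH) (use Suc.prems in \<open>simp add: algebra_simps\<close>)
  ultimately show ?case by (auto simp: min_def)
qed

text \<open>
  Because \<open>t \<le> 1\<close>, the two halves of an interval together may carry what the interval carries, so
  mass can always be passed one level further down.
\<close>

lemma dyadic_flow_le_Suc:
  assumes "t \<le> 1"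
  shows "dyadic_flow t X n k m \<le> dyadic_flow t X (Suc n) k m"
proof (induction n arbitrary: k m)
  case 0
  show ?case
    using closed_dyadic_children[of k m] dyadic_weight_le_twice[OF assms, of k] by auto
next
  case (Suc n)
  show ?case
    using Suc.IH[of "Suc k" "2 * m"] Suc.IH[of "Suc k" "2 * m + 1"]
    unfolding dyadic_flow.simps(2)[of t X n] dyadic_flow.simps(2)[of t X "Suc n"] by linarith
qed

lemma incseq_dyadic_flow: "t \<le> 1 \<Longrightarrow> incseq (\<lambda>n. dyadic_flow t X n k m)"
  by (intro incseq_SucI dyadic_flow_le_Suc)

lemma bdd_above_dyadic_flow: "bdd_above (range (\<lambda>n. dyadic_flow t X n k m))"
  using dyadic_flow_le by (intro bdd_aboveI[of _ "dyadic_weight t k"]) auto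

lemma dyadic_flow_le_capacity: "dyadic_flow t X n k m \<le> dyadic_capacity t X k m"
  unfolding dyadic_capacity_def by (intro cSUP_upper bdd_above_dyadic_flow) auto

lemma dyadic_capacity_le: "dyadic_capacity t X k m \<le> dyadic_weight t k"
  unfolding dyadic_capacity_def by (intro cSUP_least dyadic_flow_le) auto

lemma dyadic_capacity_nonneg: "0 \<le> dyadic_capacity t X k m"
  using dyadic_flow_nonneg dyadic_flow_le_capacity by (rule order_trans)

lemma dyadic_capacity_mono:
  assumes "closed_dyadic k m \<inter> X \<subseteq> Y"
  shows "dyadic_capacity t X k m \<le> dyadic_capacity t Y k m"
proof -
  have "dyadic_flow t X n k m \<le> dyadic_flow t Y n k m" for n
    using assms
  proof (induction n arbitrary: k m)
    case (Suc n)
    have "closed_dyadic (Suc k) (2 * m) \<inter> X \<subseteq> Y" "closed_dyadic (Suc k) (2 * m + 1) \<inter> X \<subseteq> Y"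
      using Suc.prems closed_dyadic_children[of k m] by blast+
    from this[THEN Suc.IH] show ?case by (auto simp: min_def)
  qed auto
  then show ?thesis
    unfolding dyadic_capacity_def by (intro cSUP_mono bdd_above_dyadic_flow) auto
qed

lemma dyadic_capacity_full: "closed_dyadic k m \<subseteq> X \<Longrightarrow> dyadic_capacity t X k m = dyadic_weight t k"
  using dyadic_flow_le_capacity[of t X 0 k m] dyadic_capacity_le[of t X k m] by simp

lemma LIMSEQ_dyadic_flow:
  "t \<le> 1 \<Longrightarrow> (\<lambda>n. dyadic_flow t X n k m) \<longlonglongrightarrow> dyadic_capacity t X k m"
  unfolding dyadic_capacity_def by (intro LIMSEQ_incseq_SUP bdd_above_dyadic_flow incseq_dyadic_flow)

lemma dyadic_capacity_rec:
  assumes "t \<le> 1"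
  shows "dyadic_capacity t X k m =
    min (dyadic_weight t k) (dyadic_capacity t X (Suc k) (2 * m) + dyadic_capacity t X (Suc k) (2 * m + 1))"
proof (rule LIMSEQ_unique)
  show "(\<lambda>n. dyadic_flow t X (Suc n) k m) \<longlonglongrightarrow> dyadic_capacity t X k m"
    by (rule LIMSEQ_Suc) (rule LIMSEQ_dyadic_flow[OF assms])
  show "(\<lambda>n. dyadic_flow t X (Suc n) k m) \<longlonglongrightarrow>
    min (dyadic_weight t k) (dyadic_capacity t X (Suc k) (2 * m) + dyadic_capacity t X (Suc k) (2 * m + 1))"
    unfolding dyadic_flow.simps by (intro tendsto_intros LIMSEQ_dyadic_flow assms)
qed

lemma hausdorff_content_le_finite_sums:
  fixes D :: "'i::countable \<Rightarrow> 'a::metric_space set"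
  assumes "A \<subseteq> (\<Union>p\<in>S. D p)" and "\<And>p. bounded (D p)"
    and fin: "\<And>P. finite P \<Longrightarrow> P \<subseteq> S \<Longrightarrow> (\<Sum>p\<in>P. diameter (D p) powr t) \<le> c"
  shows "hausdorff_content t A \<le> ennreal c"
proof -
  define J where "J = {i. from_nat i \<in> S \<and> to_nat (from_nat i :: 'i) = i}"
  define U where "U i = (if i \<in> J then D (from_nat i) else {})" for i
  have "A \<subseteq> (\<Union>i. U i)"
  proof
    fix x assume "x \<in> A"
    then obtain p where "p \<in> S" "x \<in> D p" using assms(1) by blast
    then show "x \<in> (\<Union>i. U i)" unfolding U_def J_def by (intro UN_I[of "to_nat p"]) auto
  qed
  then have "hausdorff_content t A \<le> (\<Sum>i. ennreal (diameter (U i) powr t))"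
    using assms(2) by (intro hausdorff_content_le_cover) (auto simp: U_def)
  also have "\<dots> \<le> ennreal c"
    unfolding suminf_eq_SUP
  proof (rule SUP_least)
    fix N :: nat
    have "(\<Sum>i<N. ennreal (diameter (U i) powr t)) = ennreal (\<Sum>i<N. diameter (U i) powr t)" by simp
    also have "(\<Sum>i<N. diameter (U i) powr t) = (\<Sum>i\<in>{..<N} \<inter> J. diameter (D (from_nat i)) powr t)"
      by (subst sum.inter_restrict) (auto simp: U_def intro!: sum.cong)
    also have "\<dots> = (\<Sum>p\<in>from_nat ` ({..<N} \<inter> J). diameter (D p) powr t)"
    proof -
      have "inj_on (from_nat :: nat \<Rightarrow> 'i) ({..<N} \<inter> J)"
        by (rule inj_on_inverseI[where g = to_nat]) (simp add: J_def)
      then show ?thesis by (simp add: sum.reindex)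
    qed
    also have "\<dots> \<le> c" by (rule fin) (auto simp: J_def)
    finally show "(\<Sum>i<N. ennreal (diameter (U i) powr t)) \<le> ennreal c" by (simp add: ennreal_leI)
  qed
  finally show ?thesis .
qed

text \<open>
  Descend from \<open>(k, m)\<close> and stop at the first interval of capacity \<open>\<bar>J\<bar> powr t\<close>, or give up after
  \<open>n\<close> levels.
\<close>

primrec saturated_cover :: "real \<Rightarrow> real set \<Rightarrow> nat \<Rightarrow> nat \<Rightarrow> int \<Rightarrow> (nat \<times> int) set" where
  "saturated_cover t X 0 k m = (if dyadic_capacity t X k m = dyadic_weight t k then {(k, m)} else {})"
| "saturated_cover t X (Suc n) k m = (if dyadic_capacity t X k m = dyadic_weight t k then {(k, m)}
     else saturated_cover t X n (Suc k) (2 * m) \<union> saturated_cover t X n (Suc k) (2 * m + 1))"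

lemma finite_saturated_cover: "finite (saturated_cover t X n k m)"
  by (induction n arbitrary: k m) auto

lemma saturated_cover_mono: "i \<le> n \<Longrightarrow> saturated_cover t X i k m \<subseteq> saturated_cover t X n k m"
proof (rule lift_Suc_mono_le[of "\<lambda>n. saturated_cover t X n k m"])
  show "saturated_cover t X n k m \<subseteq> saturated_cover t X (Suc n) k m" for n
  proof (induction n arbitrary: k m)
    case (Suc n)
    show ?case
      using Suc.IH[of "Suc k" "2 * m"] Suc.IH[of "Suc k" "2 * m + 1"]
      unfolding saturated_cover.simps(2)[of t X n] saturated_cover.simps(2)[of t X "Suc n"] by auto
  qed simp
qed

text \<open>
  At an interval that is not saturated the minimum in the recursion is attained by the children, so
  the capacity is passed on to them without loss.
\<close>

lemma sum_saturated_cover_le: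
  assumes "t \<le> 1"
  shows "(\<Sum>p\<in>saturated_cover t X n k m. dyadic_weight t (fst p)) \<le> dyadic_capacity t X k m"
proof (induction n arbitrary: k m)
  case 0
  show ?case by (simp add: dyadic_capacity_nonneg)
next
  case (Suc n)
  show ?case
  proof (cases "dyadic_capacity t X k m = dyadic_weight t k")
    case False
    let ?A = "saturated_cover t X n (Suc k) (2 * m)" and ?B = "saturated_cover t X n (Suc k) (2 * m + 1)"
    have "(\<Sum>p\<in>?A \<union> ?B. dyadic_weight t (fst p))
        \<le> (\<Sum>p\<in>?A. dyadic_weight t (fst p)) + (\<Sum>p\<in>?B. dyadic_weight t (fst p))"
      using sum.union_inter[of ?A ?B "\<lambda>p. dyadic_weight t (fst p)"] finite_saturated_cover
        sum_nonneg[of "?A \<inter> ?B" "\<lambda>p. dyadic_weight t (fst p)"] by fastforce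
    also have "\<dots> \<le> dyadic_capacity t X (Suc k) (2 * m) + dyadic_capacity t X (Suc k) (2 * m + 1)"
      by (intro add_mono Suc.IH)
    also have "\<dots> = dyadic_capacity t X k m"
      using dyadic_capacity_rec[OF assms, of X k m] False by (auto simp: min_def split: if_splits)
    finally show ?thesis using False by simp
  qed simp
qed

lemma saturated_cover_covers:
  assumes "x \<in> dyadic k m"
    and "dyadic_capacity t X (k + n) \<lfloor>2 ^ (k + n) * x\<rfloor> = dyadic_weight t (k + n)"
  shows "\<exists>p\<in>saturated_cover t X n k m. x \<in> dyadic (fst p) (snd p)"
  using assms
proof (induction n arbitrary: k m)
  case 0
  then show ?case by (simp add: dyadic_def)
next
  case (Suc n)
  show ?case
  proof (cases "dyadic_capacity t X k m = dyadic_weight t k")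
    case False
    have "dyadic_capacity t X (Suc k + n) \<lfloor>2 ^ (Suc k + n) * x\<rfloor> = dyadic_weight t (Suc k + n)"
      using Suc.prems(2) by simp
    moreover have "x \<in> dyadic (Suc k) (2 * m) \<or> x \<in> dyadic (Suc k) (2 * m + 1)"
      using Suc.prems(1) dyadic_split by blast
    ultimately show ?thesis using Suc.IH[of "Suc k"] False by auto
  qed (use Suc.prems in auto)
qed

text \<open>
  Strong duality for open sets: a point of \<open>X\<close> lies in some dyadic interval with closure inside
  \<open>X\<close>, which is saturated, so the saturated intervals form a cover.
\<close>

lemma hausdorff_content_le_dyadic_capacity:
  assumes "open X" "0 < t" "t \<le> 1"
  shows "hausdorff_content t (X \<inter> dyadic k m) \<le> ennreal (dyadic_capacity t X k m)"
proof (rule hausdorff_content_le_finite_sums[where D = "\<lambda>p. dyadic (fst p) (snd p)" and S = "\<Union>n. saturated_cover t X n k m"])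
  show "X \<inter> dyadic k m \<subseteq> (\<Union>p\<in>\<Union>n. saturated_cover t X n k m. dyadic (fst p) (snd p))"
  proof
    fix x assume x: "x \<in> X \<inter> dyadic k m"
    then obtain d where d: "d > 0" "ball x d \<subseteq> X" using assms(1) openE by blast
    obtain n where n: "(1/2) ^ n < d" using real_arch_pow_inv[OF d(1), of "1/2"] by auto
    have "closed_dyadic (k + n) \<lfloor>2 ^ (k + n) * x\<rfloor> \<subseteq> X"
    proof
      fix y assume "y \<in> closed_dyadic (k + n) \<lfloor>2 ^ (k + n) * x\<rfloor>"
      moreover have "x \<in> closed_dyadic (k + n) \<lfloor>2 ^ (k + n) * x\<rfloor>"
        using dyadic_subset_closed_dyadic by (auto simp: dyadic_def)
      ultimately have "\<bar>x - y\<bar> \<le> 1 / 2 ^ (k + n)" using closed_dyadic_dist_le by blast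
      also have "\<dots> \<le> 1 / 2 ^ n" by (intro divide_left_mono power_increasing) auto
      also have "\<dots> < d" using n by (simp add: power_one_over)
      finally show "y \<in> X" using d(2) by (auto simp: dist_real_def)
    qed
    then have "dyadic_capacity t X (k + n) \<lfloor>2 ^ (k + n) * x\<rfloor> = dyadic_weight t (k + n)"
      by (rule dyadic_capacity_full)
    then obtain p where "p \<in> saturated_cover t X n k m" "x \<in> dyadic (fst p) (snd p)"
      using saturated_cover_covers[of x k m t X n] x by blast
    then show "x \<in> (\<Union>p\<in>\<Union>n. saturated_cover t X n k m. dyadic (fst p) (snd p))"
      by blast
  qed
next
  fix P assume P: "finite P" "P \<subseteq> (\<Union>n. saturated_cover t X n k m)"
  then have "\<forall>p\<in>P. \<exists>n. p \<in> saturated_cover t X n k m" by blast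
  then obtain N where N: "\<And>p. p \<in> P \<Longrightarrow> p \<in> saturated_cover t X (N p) k m" by metis
  define n where "n = Max (insert 0 (N ` P))"
  have sub: "P \<subseteq> saturated_cover t X n k m"
  proof
    fix p assume p: "p \<in> P"
    then have "N p \<le> n" using P(1) by (auto simp: n_def)
    then show "p \<in> saturated_cover t X n k m" using N[OF p] saturated_cover_mono by blast
  qed
  have "(\<Sum>p\<in>P. diameter (dyadic (fst p) (snd p)) powr t) \<le> (\<Sum>p\<in>P. dyadic_weight t (fst p))"
    using assms by (intro sum_mono powr_mono2 diameter_dyadic_le diameter_ge_0 bounded_dyadic) auto
  also have "\<dots> \<le> (\<Sum>p\<in>saturated_cover t X n k m. dyadic_weight t (fst p))"
    by (intro sum_mono2 finite_saturated_cover sub) auto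
  also have "\<dots> \<le> dyadic_capacity t X k m" by (rule sum_saturated_cover_le[OF assms(3)])
  finally show "(\<Sum>p\<in>P. diameter (dyadic (fst p) (snd p)) powr t) \<le> dyadic_capacity t X k m" .
qed (rule bounded_dyadic)

text \<open>
  The capacity of an unsaturated interval is the sum over its halves. Applying the lower bound \<open>r\<close>
  levels further down therefore improves it by the factor \<open>2 ^ (r * (1 - e))\<close>, which tends to infinity;
  the only way out is saturation. This turns any weak lower bound with exponent \<open>e < 1\<close> into the
  optimal one.
\<close>

lemma dyadic_capacity_bootstrap:
  assumes t: "t \<le> 1" and c: "0 < c" and e: "e < 1"
    and small: "\<And>k m. k0 \<le> k \<Longrightarrow> c * (1 / 2 ^ k) powr e \<le> dyadic_capacity t X k m"
  shows "dyadic_capacity t X k m = dyadic_weight t k"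
proof -
  have step: "min (dyadic_weight t k) (c * (1 / 2 ^ k) powr e * (2 powr (1 - e)) ^ r) \<le> dyadic_capacity t X k m"
    if "k0 \<le> k + r" for k m r
    using that
  proof (induction r arbitrary: k m)
    case 0
    then show ?case using small[of k m] by simp
  next
    case (Suc r)
    let ?b = "\<lambda>k r. c * (1 / 2 ^ k) powr e * (2 powr (1 - e)) ^ r"
    have "?b k (Suc r) = 2 * ?b (Suc k) r"
    proof -
      have "(1 / 2 ^ k) powr e = (2 * (1 / 2 ^ Suc k)) powr e" by simp
      also have "\<dots> = 2 powr e * (1 / 2 ^ Suc k) powr e" by (subst powr_mult) auto
      finally have "(1 / 2 ^ k) powr e * 2 powr (1 - e) = 2 powr (e + (1 - e)) * (1 / 2 ^ Suc k) powr e"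
        unfolding powr_add by simp
      then show ?thesis by (simp add: mult_ac)
    qed
    moreover have "min (dyadic_weight t (Suc k)) (?b (Suc k) r) \<le> dyadic_capacity t X (Suc k) (2 * m)"
      "min (dyadic_weight t (Suc k)) (?b (Suc k) r) \<le> dyadic_capacity t X (Suc k) (2 * m + 1)"
      using Suc.IH[of "Suc k"] Suc.prems by auto
    ultimately show ?case
      using dyadic_weight_le_twice[OF t, of k] unfolding dyadic_capacity_rec[OF t, of X k m] by linarith
  qed
  have gt1: "1 < 2 powr (1 - e)" using e by simp
  define y where "y = dyadic_weight t k / (c * (1 / 2 ^ k) powr e)"
  obtain r0 where "y < (2 powr (1 - e)) ^ r0" using real_arch_pow[OF gt1] by blast
  also have "\<dots> \<le> (2 powr (1 - e)) ^ (max r0 k0)" using gt1 by (intro power_increasing) auto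
  finally have "dyadic_weight t k < c * (1 / 2 ^ k) powr e * (2 powr (1 - e)) ^ (max r0 k0)"
    using c by (simp add: y_def pos_divide_less_eq mult_ac)
  then have "dyadic_weight t k \<le> dyadic_capacity t X k m" using step[of k "max r0 k0" m] by simp
  then show ?thesis using dyadic_capacity_le by (intro antisym)
qed

section \<open>Countable intersections\<close>

lemma dyadic_meets_imp_ancestor:
  assumes "x \<in> dyadic l j" "x \<in> dyadic k m" "k \<le> l"
  shows "j div 2 ^ (l - k) = m"
proof -
  have "2 ^ l * x / 2 ^ (l - k) = 2 ^ k * x"
    using assms(3) by (simp add: power_diff)
  then show ?thesis
    using floor_divide_real_eq_div[of "2 ^ (l - k)" "2 ^ l * x"] assms(1,2)
    unfolding dyadic_def by simp
qed

text \<open>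
  A finite cover is a cut in the tree of intervals, so it bounds every flow into \<open>X\<close>.
\<close>

lemma dyadic_flow_le_finite_cover:
  assumes "0 \<le> t" "finite P" "X \<inter> dyadic k m \<subseteq> (\<Union>p\<in>P. dyadic (fst p) (snd p))"
    and "\<And>p. p \<in> P \<Longrightarrow> fst p \<le> k + n"
  shows "dyadic_flow t X n k m \<le> (\<Sum>p\<in>P. dyadic_weight t (fst p))"
  using assms(2-4)
proof (induction n arbitrary: k m P)
  case 0
  show ?case
  proof (cases "closed_dyadic k m \<subseteq> X")
    case True
    then have "of_int m / 2 ^ k \<in> X"
      using left_endpoint_in_dyadic dyadic_subset_closed_dyadic by blast
    then obtain p where p: "p \<in> P" using 0(2) left_endpoint_in_dyadic by blast
    have "dyadic_weight t k \<le> dyadic_weight t (fst p)"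
      using 0(3)[OF p] assms(1) by (intro dyadic_weight_antimono) auto
    also have "\<dots> \<le> (\<Sum>p\<in>P. dyadic_weight t (fst p))"
      using p 0(1) by (intro member_le_sum) auto
    finally show ?thesis using True by simp
  qed (simp add: sum_nonneg)
next
  case (Suc n)
  show ?case
  proof (cases "\<exists>p\<in>P. fst p \<le> k")
    case True
    then obtain p where p: "p \<in> P" "fst p \<le> k" by blast
    have "dyadic_flow t X (Suc n) k m \<le> dyadic_weight t k" by (rule dyadic_flow_le)
    also have "\<dots> \<le> dyadic_weight t (fst p)"
      using p assms(1) by (intro dyadic_weight_antimono) auto
    also have "\<dots> \<le> (\<Sum>p\<in>P. dyadic_weight t (fst p))"
      using p Suc.prems(1) by (intro member_le_sum) auto
    finally show ?thesis .
  next
    case False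
    \<comment> \<open>all covering intervals are at least as fine as the children, so each of them meets only one child\<close>
    define Q where "Q j = {p \<in> P. snd p div 2 ^ (fst p - Suc k) = j}" for j
    have "dyadic_flow t X n (Suc k) j \<le> (\<Sum>p\<in>Q j. dyadic_weight t (fst p))"
      if j: "j \<in> {2 * m, 2 * m + 1}" for j
    proof (rule Suc.IH)
      show "finite (Q j)" using Suc.prems(1) by (simp add: Q_def)
      show "fst p \<le> Suc k + n" if "p \<in> Q j" for p
        using that Suc.prems(3)[of p] by (simp add: Q_def)
      show "X \<inter> dyadic (Suc k) j \<subseteq> (\<Union>p\<in>Q j. dyadic (fst p) (snd p))"
      proof
        fix x assume x: "x \<in> X \<inter> dyadic (Suc k) j"
        then have "x \<in> dyadic k m" using j dyadic_split by blast
        then obtain p where p: "p \<in> P" "x \<in> dyadic (fst p) (snd p)" using x Suc.prems(2) by blast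
        moreover have "Suc k \<le> fst p" using p False by (simp add: not_le Suc_le_eq)
        ultimately have "p \<in> Q j"
          using x dyadic_meets_imp_ancestor[of x "fst p" "snd p" "Suc k" j] by (simp add: Q_def)
        then show "x \<in> (\<Union>p\<in>Q j. dyadic (fst p) (snd p))" using p by blast
      qed
    qed
    then have "dyadic_flow t X (Suc n) k m
        \<le> (\<Sum>p\<in>Q (2 * m). dyadic_weight t (fst p)) + (\<Sum>p\<in>Q (2 * m + 1). dyadic_weight t (fst p))"
      by (auto intro!: min.coboundedI2 add_mono)
    also have "\<dots> = (\<Sum>p\<in>Q (2 * m) \<union> Q (2 * m + 1). dyadic_weight t (fst p))"
      using Suc.prems(1) by (subst sum.union_disjoint) (auto simp: Q_def)
    also have "\<dots> \<le> (\<Sum>p\<in>P. dyadic_weight t (fst p))"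
      using Suc.prems(1) by (intro sum_mono2) (auto simp: Q_def)
    finally show ?thesis .
  qed
qed

lemma interval_subset_two_dyadics:
  assumes "p < q" "q - p \<le> 1"
  obtains k m where "{p<..<q} \<subseteq> dyadic k m \<union> dyadic k (m + 1)" and "1 / 2 ^ k \<le> 2 * (q - p)"
proof -
  define K where "K = (LEAST k. (1/2) ^ k < q - p)"
  obtain k0 where "(1/2) ^ k0 < q - p" using real_arch_pow_inv[of "q - p" "1/2"] assms by auto
  then have K: "(1/2) ^ K < q - p" unfolding K_def by (rule LeastI)
  with assms have "K \<noteq> 0" by (intro notI) simp
  then obtain k where k: "K = Suc k"
    using not0_implies_Suc by blast
  then have "q - p \<le> (1/2) ^ k" using not_less_Least[of k "\<lambda>k. (1/2) ^ k < q - p"] by (simp add: K_def)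
  then have 1: "2 ^ k * (q - p) \<le> 1" by (simp add: power_one_over field_simps)
  have "{p<..<q} \<subseteq> dyadic k \<lfloor>2 ^ k * p\<rfloor> \<union> dyadic k (\<lfloor>2 ^ k * p\<rfloor> + 1)"
  proof
    fix x assume x: "x \<in> {p<..<q}"
    have x': "2 ^ k * p \<le> 2 ^ k * x" "2 ^ k * x < 2 ^ k * q" using x by auto
    have "\<lfloor>2 ^ k * p\<rfloor> \<le> 2 ^ k * x" "2 ^ k * x < \<lfloor>2 ^ k * p\<rfloor> + 2"
      using x' 1[unfolded right_diff_distrib] by linarith+
    then show "x \<in> dyadic k \<lfloor>2 ^ k * p\<rfloor> \<union> dyadic k (\<lfloor>2 ^ k * p\<rfloor> + 1)"
      by (auto simp: mem_dyadic_iff)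
  qed
  moreover have "1 / 2 ^ k \<le> 2 * (q - p)" using K k by (simp add: power_one_over field_simps)
  ultimately show ?thesis using that by blast
qed

text \<open>
  An interval of length \<open>d \<le> 1\<close> is contained in two dyadic ones of length at most \<open>2 * d\<close>, which
  accounts for the factor \<open>2 * 2 powr t \<le> 4\<close>.
\<close>

lemma dyadic_flow_le_interval_cover:
  assumes t: "0 < t" "t \<le> 1" and I: "finite I" "\<And>i. i \<in> I \<Longrightarrow> p i < q i" "\<And>i. i \<in> I \<Longrightarrow> q i - p i \<le> 1"
    and X: "X \<subseteq> (\<Union>i\<in>I. {p i<..<q i})"
  shows "dyadic_flow t X n k m \<le> 4 * (\<Sum>i\<in>I. (q i - p i) powr t)"
proof -
  have "\<exists>l j. {p i<..<q i} \<subseteq> dyadic l j \<union> dyadic l (j + 1) \<and> 1 / 2 ^ l \<le> 2 * (q i - p i)"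
    if "i \<in> I" for i
    using interval_subset_two_dyadics[of "p i" "q i"] I that by metis
  then obtain l j where lj: "\<And>i. i \<in> I \<Longrightarrow> {p i<..<q i} \<subseteq> dyadic (l i) (j i) \<union> dyadic (l i) (j i + 1)"
      "\<And>i. i \<in> I \<Longrightarrow> 1 / 2 ^ l i \<le> 2 * (q i - p i)"
    by metis
  have w: "dyadic_weight t (l i) \<le> 2 * (q i - p i) powr t" if "i \<in> I" for i
  proof -
    have "dyadic_weight t (l i) \<le> (2 * (q i - p i)) powr t"
      using lj(2)[OF that] t by (intro powr_mono2) auto
    also have "\<dots> = 2 powr t * (q i - p i) powr t" using I(2)[OF that] by (subst powr_mult) auto
    also have "\<dots> \<le> 2 powr 1 * (q i - p i) powr t" using t by (intro mult_right_mono powr_mono) auto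
    finally show ?thesis by simp
  qed
  define P where "P = (\<lambda>i. (l i, j i)) ` I \<union> (\<lambda>i. (l i, j i + 1)) ` I"
  \<comment> \<open>flows grow with the depth, so the depth may be increased until no covering interval is smaller than the leaves\<close>
  define N where "N = n + Max (insert 0 (l ` I))"
  have "dyadic_flow t X n k m \<le> dyadic_flow t X N k m"
    using incseq_dyadic_flow[OF t(2)] by (rule incseqD) (simp add: N_def)
  also have "\<dots> \<le> (\<Sum>p\<in>P. dyadic_weight t (fst p))"
  proof (rule dyadic_flow_le_finite_cover)
    show "X \<inter> dyadic k m \<subseteq> (\<Union>p\<in>P. dyadic (fst p) (snd p))"
      using X lj(1) unfolding P_def by fastforce
    fix p assume "p \<in> P"
    then have "fst p \<in> l ` I" unfolding P_def by auto
    then have "fst p \<le> Max (insert 0 (l ` I))" using I(1) by (intro Max_ge) auto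
    then show "fst p \<le> k + N" by (simp add: N_def)
  qed (use t I in \<open>auto simp: P_def\<close>)
  also have "\<dots> \<le> (\<Sum>p\<in>(\<lambda>i. (l i, j i)) ` I. dyadic_weight t (fst p))
      + (\<Sum>p\<in>(\<lambda>i. (l i, j i + 1)) ` I. dyadic_weight t (fst p))"
    unfolding P_def using I(1) by (subst sum.union_inter[symmetric]) (auto intro!: sum_nonneg)
  also have "\<dots> \<le> (\<Sum>i\<in>I. dyadic_weight t (l i)) + (\<Sum>i\<in>I. dyadic_weight t (l i))"
    using sum_image_le[of I "\<lambda>p. dyadic_weight t (fst p)" "\<lambda>i. (l i, j i)"]
      sum_image_le[of I "\<lambda>p. dyadic_weight t (fst p)" "\<lambda>i. (l i, j i + 1)"] I(1)
    by (intro add_mono) (auto simp: o_def)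
  also have "\<dots> \<le> 4 * (\<Sum>i\<in>I. (q i - p i) powr t)"
    using sum_mono[of I "\<lambda>i. dyadic_weight t (l i)", OF w] by (simp add: sum_distrib_left[symmetric])
  finally show ?thesis .
qed

text \<open>
  Each dyadic interval inside \<open>X\<close> at which a flow ends can be used in full by \<open>X \<inter> O'\<close> as well, since
  \<open>O'\<close> saturates it.
\<close>

lemma dyadic_flow_le_capacity_Int:
  assumes t: "t \<le> 1" and full: "\<And>k m. dyadic_capacity t O' k m = dyadic_weight t k"
  shows "dyadic_flow t X n k m \<le> dyadic_capacity t (X \<inter> O') k m"
proof (induction n arbitrary: k m)
  case 0
  show ?case
  proof (cases "closed_dyadic k m \<subseteq> X")
    case True
    then have "dyadic_capacity t O' k m \<le> dyadic_capacity t (X \<inter> O') k m"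
      by (intro dyadic_capacity_mono) blast
    then show ?thesis using True full by simp
  qed (simp add: dyadic_capacity_nonneg)
next
  case (Suc n)
  show ?case
    using Suc.IH[of "Suc k" "2 * m"] Suc.IH[of "Suc k" "2 * m + 1"]
    unfolding dyadic_capacity_rec[OF t, of "X \<inter> O'" k m] dyadic_flow.simps by linarith
qed

lemma compact_subset_with_large_flow:
  assumes t: "t \<le> 1" and full: "\<And>k m. dyadic_capacity t O' k m = dyadic_weight t k"
    and flow: "a < dyadic_flow t X n 0 0"
  obtains Y n' where "compact Y" "Y \<subseteq> X \<inter> O'" "a < dyadic_flow t Y n' 0 0"
proof -
  have "a < dyadic_capacity t (X \<inter> O') 0 0"
    using flow dyadic_flow_le_capacity_Int[OF t full] by (rule less_le_trans)
  then obtain N where N: "a < dyadic_flow t (X \<inter> O') N 0 0"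
    unfolding dyadic_capacity_def by (subst (asm) less_cSUP_iff) (auto intro: bdd_above_dyadic_flow)
  define Y where "Y = (\<Union>j\<in>{j. 0 \<le> j \<and> j < 2 ^ N \<and> closed_dyadic N j \<subseteq> X \<inter> O'}. closed_dyadic N j)"
  have "finite {j::int. 0 \<le> j \<and> j < 2 ^ N \<and> closed_dyadic N j \<subseteq> X \<inter> O'}"
    by (rule finite_subset[of _ "{0..<2 ^ N}"]) auto
  then have "compact Y" unfolding Y_def by (intro compact_UN) (auto simp: closed_dyadic_def)
  moreover have "Y \<subseteq> X \<inter> O'" unfolding Y_def by blast
  moreover have "dyadic_flow t (X \<inter> O') N 0 0 \<le> dyadic_flow t Y N 0 0"
    by (rule dyadic_flow_transfer) (auto simp: Y_def)
  ultimately show ?thesis using that[of Y N] N by linarith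
qed

text \<open>
  Choose compact sets \<open>K 0 \<supseteq> K 1 \<supseteq> \<dots>\<close> with \<open>K (Suc j) \<subseteq> V j\<close>, each carrying a flow larger than
  \<open>1/2\<close>. A cover of their intersection by open intervals covers some \<open>K j\<close> by finitely many of them,
  and a cover of small sum would bound that flow by \<open>1/2\<close>.
\<close>

lemma hausdorff_content_INT_pos:
  fixes V :: "nat \<Rightarrow> real set"
  assumes t: "0 < t" "t \<le> 1"
    and full: "\<And>j k m. dyadic_capacity t (V j) k m = dyadic_weight t k"
  shows "0 < hausdorff_content t (\<Inter>j. V j)"
proof -
  have "\<exists>S. \<forall>j. (compact (fst (S j)) \<and> 1/2 < dyadic_flow t (fst (S j)) (snd (S j)) 0 0) \<and> fst (S (Suc j)) \<subseteq> fst (S j) \<inter> V j"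
  proof (rule dependent_nat_choice)
    have "1/2 < dyadic_flow t (closed_dyadic 0 0) 0 0 0" by simp
    moreover have "compact (closed_dyadic 0 0)" by (simp add: closed_dyadic_def)
    ultimately show "\<exists>S. compact (fst S) \<and> 1/2 < dyadic_flow t (fst S) (snd S) 0 0"
      by (metis fst_conv snd_conv)
  next
    fix S :: "real set \<times> nat" and j
    assume "compact (fst S) \<and> 1/2 < dyadic_flow t (fst S) (snd S) 0 0"
    then obtain Y n where "compact Y" "Y \<subseteq> fst S \<inter> V j" "1/2 < dyadic_flow t Y n 0 0"
      using compact_subset_with_large_flow[OF t(2) full] by blast
    then show "\<exists>S'. (compact (fst S') \<and> 1/2 < dyadic_flow t (fst S') (snd S') 0 0) \<and> fst S' \<subseteq> fst S \<inter> V j"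
      by (intro exI[of _ "(Y, n)"]) auto
  qed
  then obtain S :: "nat \<Rightarrow> real set \<times> nat" where S: "\<And>j. compact (fst (S j))"
      "\<And>j. 1/2 < dyadic_flow t (fst (S j)) (snd (S j)) 0 0" "\<And>j. fst (S (Suc j)) \<subseteq> fst (S j) \<inter> V j"
    by blast
  define K where "K j = fst (S j)" for j
  have K_anti: "K n \<subseteq> K m" if "m \<le> n" for m n
    using that by (rule lift_Suc_antimono_le[rotated]) (use S(3) in \<open>auto simp: K_def\<close>)
  have K_sub: "(\<Inter>j. K j) \<subseteq> (\<Inter>j. V j)" using S(3) unfolding K_def by blast
  have "\<not> hausdorff_content t (\<Inter>j. V j) < ennreal (1/8)"
  proof
    assume "hausdorff_content t (\<Inter>j. V j) < ennreal (1/8)"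
    from hausdorff_content_less_open_cover[OF this t(1)]
    obtain p q :: "nat \<Rightarrow> real" where pq: "\<And>i. p i < q i" "(\<Inter>j. V j) \<subseteq> (\<Union>i. {p i<..<q i})"
      and sum: "(\<Sum>i. ennreal ((q i - p i) powr t)) < ennreal (1/8)" by blast
    have fin_sum: "(\<Sum>i\<in>I. (q i - p i) powr t) \<le> 1/8" if "finite I" for I
    proof -
      have "ennreal (\<Sum>i\<in>I. (q i - p i) powr t) = (\<Sum>i\<in>I. ennreal ((q i - p i) powr t))" by simp
      also have "\<dots> \<le> (\<Sum>i. ennreal ((q i - p i) powr t))" using that by (intro sum_le_suminf) auto
      also have "\<dots> \<le> ennreal (1/8)" using sum by (rule less_imp_le)
      finally show ?thesis by simp
    qed
    have short: "q i - p i \<le> 1" for i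
    proof (rule ccontr)
      assume "\<not> q i - p i \<le> 1"
      then have "1 powr t \<le> (q i - p i) powr t" using t by (intro powr_mono2) auto
      then show False using fin_sum[of "{i}"] by simp
    qed
    have "\<exists>j. K j \<subseteq> (\<Union>i. {p i<..<q i})"
    proof (rule ccontr)
      assume "\<nexists>j. K j \<subseteq> (\<Union>i. {p i<..<q i})"
      then have "\<And>j. K j - (\<Union>i. {p i<..<q i}) \<noteq> {}" by blast
      moreover have "\<And>j. compact (K j - (\<Union>i. {p i<..<q i}))"
        using S(1) unfolding K_def by (intro compact_diff) auto
      moreover have "\<And>m n. m \<le> n \<Longrightarrow> K n - (\<Union>i. {p i<..<q i}) \<subseteq> K m - (\<Union>i. {p i<..<q i})"
        using K_anti by blast
      ultimately have "(\<Inter>j. K j - (\<Union>i. {p i<..<q i})) \<noteq> {}" by (intro compact_nest)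
      then obtain x where x: "x \<in> (\<Inter>j. K j - (\<Union>i. {p i<..<q i}))" by blast
      then have "x \<in> (\<Inter>j. K j)" and out: "x \<notin> (\<Union>i. {p i<..<q i})" by auto
      from this(1) have "x \<in> (\<Union>i. {p i<..<q i})" by (intro subsetD[OF pq(2)] subsetD[OF K_sub])
      with out show False by contradiction
    qed
    then obtain j where j: "K j \<subseteq> (\<Union>i. {p i<..<q i})" by blast
    have "compact (K j)" using S(1) by (simp add: K_def)
    then obtain I where I: "I \<subseteq> UNIV" "finite I" "K j \<subseteq> (\<Union>i\<in>I. {p i<..<q i})"
      by (rule compactE_image[OF _ _ j]) (simp, erule (2) that)
    have "dyadic_flow t (K j) (snd (S j)) 0 0 \<le> 4 * (\<Sum>i\<in>I. (q i - p i) powr t)"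
      using t I(2) pq(1) short I(3) by (rule dyadic_flow_le_interval_cover)
    also have "\<dots> \<le> 1/2" using fin_sum[OF I(2)] by simp
    finally show False using S(2)[of j] unfolding K_def by simp
  qed
  moreover have "0 < ennreal (1/8)" by simp
  ultimately show ?thesis by order
qed

text \<open>
  For open \<open>G\<close> and \<open>t \<le> 1\<close> every exponent \<open>e < 1\<close> leads to saturation of all dyadic intervals. If
  \<open>e \<noteq> t\<close> the estimate is not scale invariant; the constants \<open>c\<close> and \<open>l\<close> absorb the ratio of a
  similarity.
\<close>

definition locally_large :: "real \<Rightarrow> real set \<Rightarrow> bool" where
  "locally_large t G \<longleftrightarrow> (\<exists>c>0. \<exists>e<1. \<exists>l>0. \<forall>a b. a < b \<and> b - a \<le> l \<longrightarrow>
     ennreal (c * (b - a) powr e) \<le> hausdorff_content t (G \<inter> {a<..<b}))"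

lemma locally_large_mono:
  assumes "locally_large t G" "G \<subseteq> H"
  shows "locally_large t H"
proof -
  have "hausdorff_content t (G \<inter> {a<..<b}) \<le> hausdorff_content t (H \<inter> {a<..<b})" for a b
    using assms(2) by (intro hausdorff_content_mono) blast
  then show ?thesis using assms(1) unfolding locally_large_def by (meson order_trans)
qed

lemma locally_large_affine:
  assumes G: "locally_large t G" and r: "r \<noteq> 0" and t: "0 < t"
  shows "locally_large t ((\<lambda>x. r * x + d) ` G)"
proof -
  obtain c e l where c: "0 < c" "e < 1" "0 < l"
    and large: "\<And>a b. a < b \<Longrightarrow> b - a \<le> l \<Longrightarrow> ennreal (c * (b - a) powr e) \<le> hausdorff_content t (G \<inter> {a<..<b})"
    using G unfolding locally_large_def by blast
  define g where "g x = r * x + d" for x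
  define c' where "c' = c * (1 / \<bar>r\<bar>) powr e * \<bar>r\<bar> powr t"
  have "ennreal (c' * (b - a) powr e) \<le> hausdorff_content t (g ` G \<inter> {a<..<b})"
    if ab: "a < b" "b - a \<le> \<bar>r\<bar> * l" for a b
  proof -
    define a' where "a' = (if r > 0 then (a - d) / r else (b - d) / r)"
    define b' where "b' = (if r > 0 then (b - d) / r else (a - d) / r)"
    have len: "b' - a' = (b - a) / \<bar>r\<bar>"
      using r unfolding a'_def b'_def by (auto simp: field_simps)
    have mem: "g x \<in> {a<..<b} \<longleftrightarrow> x \<in> {a'<..<b'}" for x
      using r unfolding a'_def b'_def g_def by (auto simp: field_simps)
    have img: "(\<lambda>y. (1 / r) * y + (- d / r)) ` (g ` G \<inter> {a<..<b}) = G \<inter> {a'<..<b'}"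
    proof -
      have inv: "(1 / r) * g x + (- d / r) = x" for x using r by (simp add: g_def field_simps)
      have "g ` G \<inter> {a<..<b} = g ` (G \<inter> {a'<..<b'})" using mem by blast
      then show ?thesis by (simp only: image_image inv image_ident)
    qed
    have "ennreal (c * (b' - a') powr e) \<le> hausdorff_content t (G \<inter> {a'<..<b'})"
    proof (rule large)
      have "0 < b' - a'" unfolding len using ab r by simp
      then show "a' < b'" by simp
      show "b' - a' \<le> l" unfolding len using ab(2) r by (simp add: pos_divide_le_eq mult.commute)
    qed
    also have "\<dots> \<le> ennreal (\<bar>1 / r\<bar> powr t) * hausdorff_content t (g ` G \<inter> {a<..<b})"
      unfolding img[symmetric] using r t by (intro hausdorff_content_affine_le) auto
    finally have "ennreal (\<bar>r\<bar> powr t) * ennreal (c * (b' - a') powr e)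
        \<le> ennreal (\<bar>r\<bar> powr t) * (ennreal (\<bar>1 / r\<bar> powr t) * hausdorff_content t (g ` G \<inter> {a<..<b}))"
      by (intro mult_left_mono) auto
    also have "\<dots> = hausdorff_content t (g ` G \<inter> {a<..<b})"
    proof -
      have "ennreal (\<bar>r\<bar> powr t) * ennreal (\<bar>1 / r\<bar> powr t) = 1"
        using r by (simp flip: ennreal_mult powr_mult)
      then show ?thesis by (simp only: mult.assoc[symmetric] mult_1)
    qed
    also have "ennreal (\<bar>r\<bar> powr t) * ennreal (c * (b' - a') powr e) = ennreal (c' * (b - a) powr e)"
    proof -
      have "(b' - a') powr e = (1 / \<bar>r\<bar>) powr e * (b - a) powr e"
        unfolding len using ab by (simp flip: powr_mult)
      then show ?thesis using c by (simp add: c'_def mult_ac flip: ennreal_mult)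
    qed
    finally show ?thesis .
  qed
  moreover have "0 < c'" "0 < \<bar>r\<bar> * l" using c r by (auto simp: c'_def)
  ultimately show ?thesis
    using c(2) unfolding locally_large_def g_def by blast
qed

lemma dyadic_capacity_full_if_locally_large:
  assumes X: "open X" "locally_large t X" and t: "0 < t" "t \<le> 1"
  shows "dyadic_capacity t X k m = dyadic_weight t k"
proof -
  obtain c e l where c: "0 < c" "e < 1" "0 < l"
    and large: "\<And>a b. a < b \<Longrightarrow> b - a \<le> l \<Longrightarrow> ennreal (c * (b - a) powr e) \<le> hausdorff_content t (X \<inter> {a<..<b})"
    using X(2) unfolding locally_large_def by blast
  obtain k0 where k0: "(1/2) ^ k0 < l" using real_arch_pow_inv[of l "1/2"] c by auto
  show ?thesis
  proof (rule dyadic_capacity_bootstrap[OF t(2) c(1,2)])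
    fix k m assume "k0 \<le> k"
    define a where "a = of_int m / (2::real) ^ k"
    define b where "b = (of_int m + 1) / (2::real) ^ k"
    have len: "b - a = 1 / 2 ^ k" by (simp add: a_def b_def add_divide_distrib)
    have "(1/2::real) ^ k \<le> (1/2) ^ k0" using \<open>k0 \<le> k\<close> by (intro power_decreasing) auto
    with k0 len have short: "b - a \<le> l" by (simp add: power_one_over)
    have "a < b" using len by (smt (verit) zero_less_divide_1_iff zero_less_power)
    then have "ennreal (c * (b - a) powr e) \<le> hausdorff_content t (X \<inter> {a<..<b})"
      using short by (rule large)
    also have "\<dots> \<le> hausdorff_content t (X \<inter> dyadic k m)"
      by (intro hausdorff_content_mono) (auto simp: a_def b_def mem_dyadic_iff field_simps)
    also have "\<dots> \<le> ennreal (dyadic_capacity t X k m)"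
      using X(1) t by (rule hausdorff_content_le_dyadic_capacity)
    finally show "c * (1 / 2 ^ k) powr e \<le> dyadic_capacity t X k m"
      using len dyadic_capacity_nonneg by (simp add: ennreal_le_iff)
  qed
qed

lemma gdelta_in_euclidean_sequenceE:
  fixes G :: "'a::topological_space set"
  assumes "gdelta_in euclidean G"
  obtains V :: "nat \<Rightarrow> 'a set" where "\<And>i. open (V i)" "G = (\<Inter>i. V i)"
proof -
  obtain \<U> where \<U>: "countable \<U>" "\<U> \<subseteq> Collect open" "\<Inter>\<U> = G"
    using assms unfolding gdelta_in_alt intersection_of_def by auto
  have range: "range (from_nat_into (insert UNIV \<U>)) = insert UNIV \<U>"
    using \<U>(1) by (intro range_from_nat_into) auto
  have "open (from_nat_into (insert UNIV \<U>) i)" for i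
    using from_nat_into[of "insert UNIV \<U>" i] \<U>(2) by auto
  moreover have "G = (\<Inter>i. from_nat_into (insert UNIV \<U>) i)"
    unfolding range using \<U>(3) by simp
  ultimately show ?thesis using that by blast
qed

lemma hausdorff_dim_INT_ge:
  fixes G :: "nat \<Rightarrow> real set"
  assumes G: "\<And>i. gdelta_in euclidean (G i)" and s: "s \<le> 1"
    and large: "\<And>i t. 0 < t \<Longrightarrow> t < s \<Longrightarrow> locally_large t (G i)"
  shows "ennreal s \<le> hausdorff_dim (\<Inter>i. G i)"
  unfolding hausdorff_dim_def
proof (rule Inf_greatest, clarify)
  fix t assume t: "0 < t" "hausdorff_measure t (\<Inter>i. G i) = 0"
  have "\<exists>V :: nat \<Rightarrow> real set. (\<forall>j. open (V j)) \<and> G i = (\<Inter>j. V j)" for i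
    using gdelta_in_euclidean_sequenceE[OF G[of i]] by metis
  then obtain V :: "nat \<Rightarrow> nat \<Rightarrow> real set" where V: "\<And>i j. open (V i j)" "\<And>i. G i = (\<Inter>j. V i j)"
    by metis
  define W where "W n = case_prod V (prod_decode n)" for n
  have W: "(\<Inter>i. G i) = (\<Inter>n. W n)"
  proof -
    have "V i j = W (prod_encode (i, j))" for i j by (simp add: W_def)
    moreover have "\<exists>i j. W n = V i j" for n by (auto simp: W_def split: prod.split)
    ultimately show ?thesis unfolding V(2) by (auto; metis)
  qed
  have "s \<le> t"
  proof (rule ccontr)
    assume "\<not> s \<le> t"
    have "dyadic_capacity t (W n) k m = dyadic_weight t k" for n k m
    proof (rule dyadic_capacity_full_if_locally_large)
      obtain i j where ij: "W n = V i j" by (metis W_def prod.case_eq_if)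
      show "open (W n)" using V(1) ij by simp
      show "locally_large t (W n)"
        using large[of t i] t \<open>\<not> s \<le> t\<close> V(2)[of i] ij by (auto intro: locally_large_mono)
    qed (use t s \<open>\<not> s \<le> t\<close> in auto)
    then have "0 < hausdorff_content t (\<Inter>n. W n)"
      using t s \<open>\<not> s \<le> t\<close> by (intro hausdorff_content_INT_pos) auto
    also have "\<dots> \<le> hausdorff_measure t (\<Inter>i. G i)"
      unfolding W by (rule hausdorff_content_le_measure)
    finally show False using t by simp
  qed
  then show "ennreal s \<le> ennreal t" by (rule ennreal_leI)
qed

lemma similarity_real_affineE:
  fixes g :: "real \<Rightarrow> real"
  assumes "similarity g"
  obtains r c where "r \<noteq> 0" "g = (\<lambda>x. r * x + c)"
proof -
  obtain \<rho> where \<rho>: "\<rho> > 0" and dist: "\<And>x y. \<bar>g x - g y\<bar> = \<rho> * \<bar>x - y\<bar>"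
    using assms unfolding similarity_def dist_real_def by blast
  define h where "h x = g x - g 0" for x
  \<comment> \<open>squaring removes the absolute values; polarisation at \<open>1\<close> then gives linearity\<close>
  have sq: "(h x - h y)\<^sup>2 = \<rho>\<^sup>2 * (x - y)\<^sup>2" for x y
    using dist[of x y] by (metis (no_types) diff_diff_eq2 diff_add_cancel h_def power2_abs power_mult_distrib)
  have h0: "h 0 = 0" by (simp add: h_def)
  have h1: "(h 1)\<^sup>2 = \<rho>\<^sup>2" using sq[of 1 0] h0 by simp
  have linear: "h x = h 1 * x" for x
  proof -
    have "(h x)\<^sup>2 = \<rho>\<^sup>2 * x\<^sup>2" using sq[of x 0] h0 by simp
    moreover have "(h x - h 1)\<^sup>2 = \<rho>\<^sup>2 * (x - 1)\<^sup>2" by (rule sq)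
    ultimately have "h x * h 1 = (h 1)\<^sup>2 * x" using h1 by (simp add: power2_eq_square algebra_simps)
    moreover have "h 1 \<noteq> 0" using h1 \<rho> by auto
    ultimately show ?thesis by (simp add: power2_eq_square)
  qed
  have "g = (\<lambda>x. h 1 * x + g 0)"
  proof
    fix x
    have "g x = h x + g 0" by (simp add: h_def)
    then show "g x = h 1 * x + g 0" by (simp only: linear[of x])
  qed
  moreover have "h 1 \<noteq> 0" using h1 \<rho> by auto
  ultimately show ?thesis using that by blast
qed

lemma gdelta_in_affine_image:
  fixes G :: "real set"
  assumes "gdelta_in euclidean G" "r \<noteq> 0"
  shows "gdelta_in euclidean ((\<lambda>x. r * x + c) ` G)"
proof -
  obtain V :: "nat \<Rightarrow> real set" where V: "\<And>i. open (V i)" "G = (\<Inter>i. V i)"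
    using gdelta_in_euclidean_sequenceE[OF assms(1)] by blast
  have "(\<lambda>x. r * x + c) ` G = (\<Inter>i. (\<lambda>x. r * x + c) ` V i)"
    unfolding V(2) using assms(2) by (intro image_INT[of _ UNIV]) (auto simp: inj_on_def)
  moreover have "open ((\<lambda>x. r * x + c) ` V i)" for i
    using open_affinity[OF V(1)[of i] assms(2), of c] by (simp add: add.commute)
  ultimately show ?thesis
    by (simp only:) (rule gdelta_in_Inter, auto intro: open_imp_gdelta_in)
qed

text \<open>
  Largeness in short intervals survives similarities and passes to each open set in a representation
  of a \<open>G\<^sub>\<delta>\<close> set, where it implies saturation, and saturated open sets may be intersected countably often.
\<close>

lemma falconer_classI:
  assumes F: "gdelta_in euclidean F" and s: "s \<le> 1"
    and large: "\<And>t. 0 < t \<Longrightarrow> t < s \<Longrightarrow> locally_large t F"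
  shows "F \<in> falconer_class s"
  unfolding falconer_class_def
proof (intro CollectI conjI allI impI F)
  fix g :: "nat \<Rightarrow> real \<Rightarrow> real"
  assume sim: "\<forall>i. similarity (g i)"
  show "ennreal s \<le> hausdorff_dim (\<Inter>i. g i ` F)"
  proof (rule hausdorff_dim_INT_ge[OF _ s])
    fix i
    obtain r c where rc: "r \<noteq> 0" "g i = (\<lambda>x. r * x + c)" using similarity_real_affineE sim by blast
    show "gdelta_in euclidean (g i ` F)" unfolding rc(2) using F rc(1) by (rule gdelta_in_affine_image)
    show "locally_large t (g i ` F)" if "0 < t" "t < s" for t
      unfolding rc(2) using large[OF that] rc(1) that(1) by (rule locally_large_affine)
  qed
qed

section \<open>Digit sequences in the beta-shift\<close>

definition lex_le :: "(nat \<Rightarrow> nat) \<Rightarrow> (nat \<Rightarrow> nat) \<Rightarrow> bool" where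
  "lex_le v w \<longleftrightarrow> v = w \<or> (\<exists>k. (\<forall>j<k. v j = w j) \<and> v k < w k)"

definition tail_from :: "nat \<Rightarrow> (nat \<Rightarrow> 'a) \<Rightarrow> nat \<Rightarrow> 'a" where
  "tail_from n w = (\<lambda>k. w (n + k))"

lemma tail_from_tail_from [simp]: "tail_from m (tail_from n w) = tail_from (n + m) w"
  by (simp add: tail_from_def add.assoc)

lemma tail_from_apply: "tail_from n w k = w (n + k)"
  by (simp add: tail_from_def)

lemma first_differenceE:
  fixes v w :: "nat \<Rightarrow> nat"
  assumes "v \<noteq> w"
  obtains k where "\<forall>j<k. v j = w j" "v k \<noteq> w k"
proof -
  have "\<exists>k. v k \<noteq> w k" using assms by auto
  then have "v (LEAST k. v k \<noteq> w k) \<noteq> w (LEAST k. v k \<noteq> w k)" by (rule LeastI_ex)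
  moreover have "\<forall>j<(LEAST k. v k \<noteq> w k). v j = w j" using not_less_Least by blast
  ultimately show ?thesis using that by blast
qed

lemma lex_le_linear: "lex_le v w \<or> lex_le w v"
proof (cases "v = w")
  case False
  then obtain k where "\<forall>j<k. v j = w j" "v k \<noteq> w k" by (rule first_differenceE)
  then show ?thesis unfolding lex_le_def by (metis nat_neq_iff)
qed (simp add: lex_le_def)

lemma geometric_digit_sums:
  fixes \<beta> :: real
  assumes "1 < \<beta>"
  shows "(\<lambda>k. M / \<beta> ^ (k + 1)) sums (M / (\<beta> - 1))"
proof -
  have sums: "(\<lambda>k. (M / \<beta>) * (1 / \<beta>) ^ k) sums ((M / \<beta>) * (1 / (1 - 1 / \<beta>)))"
    using assms by (intro sums_mult geometric_sums) auto
  have limit: "(M / \<beta>) * (1 / (1 - 1 / \<beta>)) = M / (\<beta> - 1)"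
    using assms by (simp add: field_simps)
  have terms: "(M / \<beta>) * (1 / \<beta>) ^ k = M / \<beta> ^ (k + 1)" for k
    by (simp add: power_one_over)
  show ?thesis using sums unfolding limit terms .
qed

lemma summable_beta_proj:
  assumes "1 < \<beta>" "\<And>k. real (w k) \<le> M"
  shows "summable (\<lambda>k. real (w k) / \<beta> ^ (k + 1))"
proof (rule summable_comparison_test')
  show "summable (\<lambda>k. M / \<beta> ^ (k + 1))" using geometric_digit_sums[OF assms(1)] by (rule sums_summable)
  show "norm (real (w k) / \<beta> ^ (k + 1)) \<le> M / \<beta> ^ (k + 1)" for k
    using assms by (simp add: divide_right_mono)
qed

lemma beta_proj_nonneg: "1 < \<beta> \<Longrightarrow> (\<And>k. real (w k) \<le> M) \<Longrightarrow> 0 \<le> beta_proj \<beta> w"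
  unfolding beta_proj_def using summable_beta_proj by (intro suminf_nonneg) auto

lemma beta_proj_le:
  assumes "1 < \<beta>" "\<And>k. real (w k) \<le> M"
  shows "beta_proj \<beta> w \<le> M / (\<beta> - 1)"
proof -
  have "beta_proj \<beta> w \<le> (\<Sum>k. M / \<beta> ^ (k + 1))"
    unfolding beta_proj_def
    using assms geometric_digit_sums[OF assms(1), of M] summable_beta_proj[of \<beta> w M]
    by (intro suminf_le divide_right_mono) (auto intro: sums_summable)
  then show ?thesis using geometric_digit_sums[OF assms(1), of M] by (simp add: sums_iff)
qed

lemma beta_proj_split:
  assumes "1 < \<beta>" "\<And>k. real (w k) \<le> M"
  shows "beta_proj \<beta> w = (\<Sum>k<n. real (w k) / \<beta> ^ (k + 1)) + beta_proj \<beta> (tail_from n w) / \<beta> ^ n"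
proof -
  have s: "summable (\<lambda>k. real (tail_from n w k) / \<beta> ^ (k + 1))"
    using assms by (intro summable_beta_proj[where M = M]) (auto simp: tail_from_def)
  have "beta_proj \<beta> w = (\<Sum>k. real (w (k + n)) / \<beta> ^ (k + n + 1)) + (\<Sum>k<n. real (w k) / \<beta> ^ (k + 1))"
    unfolding beta_proj_def by (rule suminf_split_initial_segment) (rule summable_beta_proj[OF assms])
  also have "(\<Sum>k. real (w (k + n)) / \<beta> ^ (k + n + 1)) = (\<Sum>k. real (tail_from n w k) / \<beta> ^ (k + 1) / \<beta> ^ n)"
    by (intro suminf_cong) (simp add: tail_from_def add.commute power_add)
  also have "\<dots> = beta_proj \<beta> (tail_from n w) / \<beta> ^ n"
    unfolding beta_proj_def by (rule suminf_divide[OF s])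
  finally show ?thesis by simp
qed

lemma beta_proj_diff:
  assumes \<beta>: "1 < \<beta>" and "\<And>k. real (v k) \<le> M" "\<And>k. real (w k) \<le> M" and eq: "\<forall>j<k. v j = w j"
  shows "beta_proj \<beta> w - beta_proj \<beta> v = (real (w k) - real (v k)
     + beta_proj \<beta> (tail_from (Suc k) w) - beta_proj \<beta> (tail_from (Suc k) v)) / \<beta> ^ Suc k"
proof -
  have "(\<Sum>j<k. real (v j) / \<beta> ^ (j + 1)) = (\<Sum>j<k. real (w j) / \<beta> ^ (j + 1))"
    using eq by (intro sum.cong) auto
  then show ?thesis
    using \<beta> beta_proj_split[of \<beta> v M "Suc k"] beta_proj_split[of \<beta> w M "Suc k"] assms(2,3)
    by (simp add: diff_divide_distrib add_divide_distrib)
qed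

text \<open>
  At the first difference \<open>w\<close> gains at least one unit, while the tail of \<open>v\<close> is worth at most one.
\<close>

lemma beta_proj_mono_lex:
  assumes \<beta>: "1 < \<beta>" and "\<And>k. real (v k) \<le> M" "\<And>k. real (w k) \<le> M"
    and tails: "\<And>k. beta_proj \<beta> (tail_from k v) \<le> 1" and lex: "lex_le v w"
  shows "beta_proj \<beta> v \<le> beta_proj \<beta> w"
proof (cases "v = w")
  case False
  then obtain k where k: "\<forall>j<k. v j = w j" "v k < w k" using lex unfolding lex_le_def by blast
  have "0 \<le> beta_proj \<beta> (tail_from (Suc k) w)"
    using \<beta> assms(3) by (intro beta_proj_nonneg[where M = M]) (auto simp: tail_from_def)
  then have "0 \<le> real (w k) - real (v k) + beta_proj \<beta> (tail_from (Suc k) w) - beta_proj \<beta> (tail_from (Suc k) v)"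
    using k(2) tails[of "Suc k"] by linarith
  then have "0 \<le> beta_proj \<beta> w - beta_proj \<beta> v"
    unfolding beta_proj_diff[OF \<beta> assms(2,3) k(1)] using \<beta> by (intro divide_nonneg_pos) auto
  then show ?thesis by simp
qed simp

lemma orbit_expansion:
  fixes \<beta> :: real
  assumes "1 < \<beta>" "\<And>k. y (Suc k) = \<beta> * y k - real (d k)"
  shows "y 0 = (\<Sum>k<n. real (d k) / \<beta> ^ (k + 1)) + y n / \<beta> ^ n"
proof (induction n)
  case (Suc n)
  have "y n / \<beta> ^ n = real (d n) / \<beta> ^ (n + 1) + y (Suc n) / \<beta> ^ Suc n"
    using assms by (simp add: field_simps)
  then show ?case using Suc by simp
qed simp

text \<open>
  Both the greedy expansions of points in \<open>[0, 1)\<close> and the quasi-greedy expansion of \<open>1\<close> are digit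
  sequences read off from a bounded orbit of this form.
\<close>

lemma beta_proj_eq_orbit:
  assumes \<beta>: "1 < \<beta>" and y: "\<And>k. y (Suc k) = \<beta> * y k - real (d k)" "\<And>k. 0 \<le> y k" "\<And>k. y k \<le> 1"
  shows "beta_proj \<beta> d = y 0"
proof -
  have "(\<lambda>n. y n / \<beta> ^ n) \<longlonglongrightarrow> 0"
  proof (rule tendsto_sandwich[of "\<lambda>_. 0" _ _ "\<lambda>n. (1 / \<beta>) ^ n"])
    show "(\<lambda>n. (1 / \<beta>) ^ n) \<longlonglongrightarrow> 0" using \<beta> by (intro LIMSEQ_power_zero) auto
  qed (use \<beta> y in \<open>auto simp: power_one_over divide_right_mono\<close>)
  then have "(\<lambda>n. y 0 - y n / \<beta> ^ n) \<longlonglongrightarrow> y 0 - 0" by (intro tendsto_intros)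
  moreover have "y 0 - y n / \<beta> ^ n = (\<Sum>k<n. real (d k) / \<beta> ^ (k + 1))" for n
    using orbit_expansion[of \<beta> y d n, OF \<beta> y(1)] by simp
  ultimately have "(\<lambda>k. real (d k) / \<beta> ^ (k + 1)) sums y 0" unfolding sums_def by simp
  then show ?thesis unfolding beta_proj_def by (simp add: sums_iff)
qed

lemma beta_map_funpow_in: "u \<in> {0..<1} \<Longrightarrow> (beta_map \<beta> ^^ k) u \<in> {0..<1}"
  by (cases k) (auto simp: beta_map_def frac_lt_1)

lemma beta_digits_step:
  assumes "1 < \<beta>" "u \<in> {0..<1}"
  shows "(beta_map \<beta> ^^ Suc k) u = \<beta> * (beta_map \<beta> ^^ k) u - real (beta_digits \<beta> u k)"
proof -
  have "0 \<le> \<beta> * (beta_map \<beta> ^^ k) u" using assms beta_map_funpow_in[of u k \<beta>] by auto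
  then show ?thesis by (simp add: beta_map_def beta_digits_def frac_def)
qed

lemma beta_digits_le:
  assumes "1 < \<beta>" "u \<in> {0..<1}"
  shows "real (beta_digits \<beta> u k) \<le> \<beta>"
proof -
  have "0 \<le> (beta_map \<beta> ^^ k) u" "(beta_map \<beta> ^^ k) u \<le> 1" "0 \<le> (beta_map \<beta> ^^ Suc k) u"
    using beta_map_funpow_in[OF assms(2), of k \<beta>] beta_map_funpow_in[OF assms(2), of "Suc k" \<beta>] by auto
  moreover have "\<beta> * (beta_map \<beta> ^^ k) u \<le> \<beta> * 1" using calculation(2) assms(1) by (intro mult_left_mono) auto
  ultimately show ?thesis using beta_digits_step[OF assms, of k] by linarith
qed

text \<open>
  The expansion of \<open>1\<close> obtained by always choosing the largest digit that leaves a positive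
  remainder, so that the orbit stays in \<open>(0, 1]\<close>. It is the lexicographic upper bound of the
  \<open>\<beta>\<close>-shift, whereas the greedy expansion of \<open>1\<close> may terminate and then lies above it.
\<close>

primrec quasi_greedy_orbit :: "real \<Rightarrow> nat \<Rightarrow> real" where
  "quasi_greedy_orbit \<beta> 0 = 1"
| "quasi_greedy_orbit \<beta> (Suc k) = \<beta> * quasi_greedy_orbit \<beta> k - of_int (\<lceil>\<beta> * quasi_greedy_orbit \<beta> k\<rceil> - 1)"

definition quasi_greedy :: "real \<Rightarrow> nat \<Rightarrow> nat" where
  "quasi_greedy \<beta> k = nat (\<lceil>\<beta> * quasi_greedy_orbit \<beta> k\<rceil> - 1)"

lemma quasi_greedy_orbit_pos_le_1: "1 < \<beta> \<Longrightarrow> 0 < quasi_greedy_orbit \<beta> k \<and> quasi_greedy_orbit \<beta> k \<le> 1"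
  by (cases k) (simp, simp, linarith)

lemma real_quasi_greedy:
  assumes "1 < \<beta>"
  shows "real (quasi_greedy \<beta> k) = of_int (\<lceil>\<beta> * quasi_greedy_orbit \<beta> k\<rceil> - 1)"
proof -
  have "0 < \<beta> * quasi_greedy_orbit \<beta> k" using assms quasi_greedy_orbit_pos_le_1[OF assms, of k] by simp
  then have "0 \<le> \<lceil>\<beta> * quasi_greedy_orbit \<beta> k\<rceil> - 1" by linarith
  then show ?thesis by (simp add: quasi_greedy_def)
qed

lemma quasi_greedy_step:
  "1 < \<beta> \<Longrightarrow> quasi_greedy_orbit \<beta> (Suc k) = \<beta> * quasi_greedy_orbit \<beta> k - real (quasi_greedy \<beta> k)"
  by (simp add: real_quasi_greedy)

lemma quasi_greedy_le:
  assumes "1 < \<beta>"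
  shows "real (quasi_greedy \<beta> k) \<le> \<beta>"
proof -
  have "\<beta> * quasi_greedy_orbit \<beta> k \<le> \<beta> * 1"
    using quasi_greedy_orbit_pos_le_1[OF assms, of k] assms by (intro mult_left_mono) auto
  then show ?thesis unfolding real_quasi_greedy[OF assms] by linarith
qed

lemma beta_proj_quasi_greedy: "1 < \<beta> \<Longrightarrow> beta_proj \<beta> (quasi_greedy \<beta>) = 1"
  using beta_proj_eq_orbit[of \<beta> "quasi_greedy_orbit \<beta>" "quasi_greedy \<beta>"]
    quasi_greedy_step quasi_greedy_orbit_pos_le_1 by (simp add: less_imp_le)

lemma beta_shift_prefix:
  assumes "w \<in> beta_shift \<beta>"
  obtains u where "u \<in> {0..<1}" "\<And>k. k < N \<Longrightarrow> w k = beta_digits \<beta> u k"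
proof -
  define C where "C = {v :: nat \<Rightarrow> nat. \<forall>k<N. v k = w k}"
  have "C = Pi\<^sub>E UNIV (\<lambda>k. if k < N then {w k} else UNIV)"
    by (auto simp: C_def PiE_iff split: if_splits)
  moreover have "open (Pi\<^sub>E UNIV (\<lambda>k. if k < N then {w k} else UNIV))"
    by (rule open_PiE) (auto simp: open_discrete)
  ultimately have "open C" by simp
  moreover have "w \<in> C" by (simp add: C_def)
  ultimately have "C \<inter> beta_digits \<beta> ` {0..<1} \<noteq> {}"
    using assms unfolding beta_shift_def closure_iff_nhds_not_empty by blast
  then obtain u where "u \<in> {0..<1}" "beta_digits \<beta> u \<in> C" by blast
  then show ?thesis using that[of u] by (simp add: C_def)
qed

lemma beta_shift_digit_le:
  assumes "1 < \<beta>" "w \<in> beta_shift \<beta>"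
  shows "real (w k) \<le> \<beta>"
  using beta_shift_prefix[OF assms(2), of "Suc k"] beta_digits_le[OF assms(1)] by (metis lessI)

lemma beta_shift_tail_proj_le_1:
  assumes \<beta>: "1 < \<beta>" and w: "w \<in> beta_shift \<beta>"
  shows "beta_proj \<beta> (tail_from n w) \<le> 1"
  unfolding beta_proj_def
proof (rule suminf_le_const)
  show "summable (\<lambda>k. real (tail_from n w k) / \<beta> ^ (k + 1))"
    using \<beta> beta_shift_digit_le[OF \<beta> w] by (intro summable_beta_proj) (auto simp: tail_from_def)
  fix N
  obtain u where u: "u \<in> {0..<1}" "\<And>k. k < n + N \<Longrightarrow> w k = beta_digits \<beta> u k"
    using beta_shift_prefix[OF w] by blast
  define y where "y k = (beta_map \<beta> ^^ (n + k)) u" for k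
  have y: "0 \<le> y k" "y k \<le> 1" for k using beta_map_funpow_in[OF u(1), of "n + k" \<beta>] by (auto simp: y_def)
  have "y 0 = (\<Sum>k<N. real (beta_digits \<beta> u (n + k)) / \<beta> ^ (k + 1)) + y N / \<beta> ^ N"
    by (rule orbit_expansion[OF \<beta>]) (use beta_digits_step[OF \<beta> u(1)] in \<open>simp add: y_def\<close>)
  also have "(\<Sum>k<N. real (beta_digits \<beta> u (n + k)) / \<beta> ^ (k + 1)) = (\<Sum>k<N. real (tail_from n w k) / \<beta> ^ (k + 1))"
    using u(2) by (intro sum.cong) (auto simp: tail_from_def)
  finally show "(\<Sum>k<N. real (tail_from n w k) / \<beta> ^ (k + 1)) \<le> 1"
    using y(1)[of N] y(2)[of 0] \<beta> by (smt (verit) divide_nonneg_pos zero_less_power)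
qed

text \<open>
  A greedy orbit starting below \<open>1\<close> stays strictly below the quasi-greedy orbit as long as the
  digits agree, so the first different digit is smaller. Only finitely many digits matter for this
  comparison, hence it extends to the closure.
\<close>

lemma beta_shift_tail_lex_le_quasi_greedy:
  assumes \<beta>: "1 < \<beta>" and w: "w \<in> beta_shift \<beta>"
  shows "lex_le (tail_from n w) (quasi_greedy \<beta>)"
proof (cases "tail_from n w = quasi_greedy \<beta>")
  case False
  then obtain p where p: "\<forall>j<p. tail_from n w j = quasi_greedy \<beta> j" "tail_from n w p \<noteq> quasi_greedy \<beta> p"
    by (rule first_differenceE)
  obtain u where u: "u \<in> {0..<1}" "\<And>k. k < n + Suc p \<Longrightarrow> w k = beta_digits \<beta> u k"
    using beta_shift_prefix[OF w] by blast
  have lt: "(beta_map \<beta> ^^ (n + j)) u < quasi_greedy_orbit \<beta> j" if "j \<le> p" for j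
    using that
  proof (induction j)
    case 0
    then show ?case using beta_map_funpow_in[OF u(1), of n \<beta>] by simp
  next
    case (Suc j)
    have "beta_digits \<beta> u (n + j) = quasi_greedy \<beta> j"
      using p(1) u(2)[of "n + j"] Suc.prems by (simp add: tail_from_def)
    then show ?case
      using Suc \<beta> beta_digits_step[OF \<beta> u(1), of "n + j"] quasi_greedy_step[OF \<beta>, of j]
      by (simp del: quasi_greedy_orbit.simps funpow.simps)
  qed
  have "\<beta> * (beta_map \<beta> ^^ (n + p)) u < \<beta> * quasi_greedy_orbit \<beta> p" using lt[of p] \<beta> by simp
  then have "\<lfloor>\<beta> * (beta_map \<beta> ^^ (n + p)) u\<rfloor> \<le> \<lceil>\<beta> * quasi_greedy_orbit \<beta> p\<rceil> - 1" by linarith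
  then have "tail_from n w p \<le> quasi_greedy \<beta> p"
    using u(2)[of "n + p"] by (simp add: tail_from_def beta_digits_def quasi_greedy_def nat_mono)
  then show ?thesis using p unfolding lex_le_def by (meson le_neq_implies_less)
qed (simp add: lex_le_def)

lemma beta_proj_base_antimono:
  assumes \<gamma>: "1 < \<gamma>" "\<gamma> \<le> \<beta>" and w: "\<And>k. real (w k) \<le> M"
  shows "beta_proj \<beta> w \<le> beta_proj \<gamma> w"
  unfolding beta_proj_def
proof (intro suminf_le summable_beta_proj[OF _ w])
  have "\<gamma> ^ (k + 1) \<le> \<beta> ^ (k + 1)" for k using \<gamma> by (intro power_mono) auto
  then show "real (w k) / \<beta> ^ (k + 1) \<le> real (w k) / \<gamma> ^ (k + 1)" for k
    using \<gamma> by (intro divide_left_mono mult_pos_pos) auto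
qed (use \<gamma> in auto)

text \<open>
  The bound is uniform in \<open>w\<close> and tends to zero as \<open>\<gamma>\<close> approaches \<open>\<beta>\<close>.
\<close>

lemma abs_beta_proj_diff_base_le:
  assumes \<gamma>: "1 < \<gamma>" "\<gamma> \<le> \<beta>" and w: "\<And>k. real (w k) \<le> M"
  shows "\<bar>beta_proj \<gamma> w - beta_proj \<beta> w\<bar> \<le> M / (\<gamma> - 1) - M / (\<beta> - 1)"
proof -
  have \<beta>: "1 < \<beta>" using \<gamma> by simp
  have pw: "\<gamma> ^ (k + 1) \<le> \<beta> ^ (k + 1)" for k using \<gamma> by (intro power_mono) auto
  have "beta_proj \<gamma> w - beta_proj \<beta> w = (\<Sum>k. real (w k) / \<gamma> ^ (k + 1) - real (w k) / \<beta> ^ (k + 1))"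
    unfolding beta_proj_def by (intro suminf_diff summable_beta_proj[where M = M] w \<gamma> \<beta>)
  also have "\<dots> \<le> (\<Sum>k. M / \<gamma> ^ (k + 1) - M / \<beta> ^ (k + 1))"
  proof (intro suminf_le summable_diff summable_beta_proj[OF _ w] \<gamma> \<beta>)
    fix k
    have "0 \<le> 1 / \<gamma> ^ (k + 1) - 1 / \<beta> ^ (k + 1)" using pw[of k] \<gamma> by (simp add: frac_le)
    from mult_right_mono[OF w this, of k]
    show "real (w k) / \<gamma> ^ (k + 1) - real (w k) / \<beta> ^ (k + 1) \<le> M / \<gamma> ^ (k + 1) - M / \<beta> ^ (k + 1)"
      by (simp add: right_diff_distrib)
  qed (use geometric_digit_sums \<gamma> \<beta> sums_summable in blast)+
  also have "\<dots> = M / (\<gamma> - 1) - M / (\<beta> - 1)"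
    using sums_diff[OF geometric_digit_sums[OF \<gamma>(1)] geometric_digit_sums[OF \<beta>]] by (rule sums_unique[symmetric])
  finally have "beta_proj \<gamma> w - beta_proj \<beta> w \<le> M / (\<gamma> - 1) - M / (\<beta> - 1)" .
  moreover have "beta_proj \<beta> w \<le> beta_proj \<gamma> w" using \<gamma> w by (rule beta_proj_base_antimono)
  ultimately show ?thesis by simp
qed

section \<open>Hoelder continuity of a change of base\<close>

text \<open>
  Here \<open>\<gamma>\<close> is a base slightly below \<open>\<beta>\<close>, and \<open>\<theta>'\<close> limits how far below. All constants depend on \<open>\<beta>\<close>, \<open>\<theta>\<close>
  and \<open>\<theta>'\<close> only, which makes the final estimate uniform in \<open>\<gamma>\<close>.
\<close>

context
  fixes \<beta> \<gamma> \<theta> \<theta>' :: real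
  assumes \<beta>: "1 < \<beta>" and \<theta>: "0 < \<theta>" "\<theta> < \<theta>'" "\<theta>' \<le> 1" and \<gamma>: "\<beta> powr \<theta>' \<le> \<gamma>" "\<gamma> \<le> \<beta>"
begin

lemma powr_base_gt_1: "1 < \<beta> powr \<theta>'" "1 < \<gamma>"
proof -
  show "1 < \<beta> powr \<theta>'" using \<beta> \<theta> by (simp add: gr_one_powr)
  then show "1 < \<gamma>" using \<gamma> by simp
qed

text \<open>
  Bounds a digit plus the value of a tail, in every base from \<open>\<beta> powr \<theta>'\<close> to \<open>\<beta>\<close>.
\<close>

definition "digit_bound = \<beta> + \<beta> / (\<beta> powr \<theta>' - 1)"

lemma digit_bound_ge: "\<beta> \<le> digit_bound"
  using \<beta> powr_base_gt_1 by (simp add: digit_bound_def)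

definition "rate = \<beta> powr (\<theta> - \<theta>')"

lemma rate_less_1: "0 < rate" "rate < 1"
  using \<beta> \<theta> by (auto simp: rate_def powr_less_one)

lemma proj_le_digit_bound:
  assumes "\<And>k. real (w k) \<le> \<beta>"
  shows "beta_proj \<gamma> w + \<beta> \<le> digit_bound"
proof -
  have "beta_proj \<gamma> w \<le> \<beta> / (\<gamma> - 1)" using assms powr_base_gt_1 by (intro beta_proj_le) auto
  also have "\<dots> \<le> \<beta> / (\<beta> powr \<theta>' - 1)" using \<beta> \<gamma> powr_base_gt_1 by (intro divide_left_mono mult_pos_pos) auto
  finally show ?thesis by (simp add: digit_bound_def)
qed

text \<open>
  The gap between \<open>\<theta>\<close> and \<open>\<theta>'\<close> is spent here: it yields a geometric factor for each digit that is
  passed, which makes the errors accumulated along the digits summable.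
\<close>

lemma inverse_power_le:
  "1 / \<gamma> ^ n \<le> rate ^ n * (1 / \<beta> ^ n) powr \<theta>"
proof -
  have "rate * (1 / \<beta>) powr \<theta> = 1 / \<beta> powr \<theta>'"
    using \<beta> by (simp add: rate_def powr_divide powr_diff)
  then have "1 / \<gamma> \<le> rate * (1 / \<beta>) powr \<theta>"
    using \<gamma> powr_base_gt_1 by (simp add: divide_left_mono)
  then have "(1 / \<gamma>) ^ n \<le> (rate * (1 / \<beta>) powr \<theta>) ^ n"
    using powr_base_gt_1 by (intro power_mono) auto
  moreover have "((1 / \<beta>) powr \<theta>) ^ n = (1 / \<beta> ^ n) powr \<theta>"
    using \<beta> by (simp add: powr_power powr_realpow[symmetric] powr_powr powr_divide mult.commute)
  ultimately show ?thesis by (simp add: power_mult_distrib power_one_over)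
qed

text \<open>
  For \<open>N \<noteq> 0\<close> both sides are of order one. For \<open>N = 0\<close> they are determined, up to constants, by the
  position of the first nonzero digit of \<open>w\<close>.
\<close>

lemma leading_term_Holder:
  assumes w: "\<And>k. real (w k) \<le> \<beta>" and N: "real N \<le> \<beta>"
  shows "real N + beta_proj \<gamma> w \<le> digit_bound * \<beta> * (real N + beta_proj \<beta> w) powr \<theta>"
proof -
  have nonneg: "0 \<le> beta_proj \<beta> w" using \<beta> w by (rule beta_proj_nonneg)
  have D: "0 \<le> digit_bound" using digit_bound_ge \<beta> by simp
  show ?thesis
  proof (cases "N = 0")
    case False
    have "real N + beta_proj \<gamma> w \<le> digit_bound" using proj_le_digit_bound[of w, OF w] N by linarith
    also have "\<dots> \<le> digit_bound * \<beta>" using D \<beta> by (simp add: mult_le_cancel_left1)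
    also have "\<dots> = digit_bound * \<beta> * 1 powr \<theta>" by simp
    also have "\<dots> \<le> digit_bound * \<beta> * (real N + beta_proj \<beta> w) powr \<theta>"
      using D \<beta> \<theta> nonneg False by (intro mult_left_mono powr_mono2) auto
    finally show ?thesis .
  next
    case True
    show ?thesis
    proof (cases "w = (\<lambda>_. 0)")
      case True
      then show ?thesis using \<open>N = 0\<close> by (simp add: beta_proj_def)
    next
      case False
      then obtain p where "\<forall>j<p. w j = (\<lambda>_. 0) j" "w p \<noteq> (\<lambda>_. 0) p" by (rule first_differenceE)
      then have p: "\<And>j. j < p \<Longrightarrow> w j = 0" "w p \<noteq> 0" by auto
      have split: "beta_proj b w = beta_proj b (tail_from p w) / b ^ p" if "1 < b" for b
        using beta_proj_split[of b w \<beta> p, OF that w] p(1) by simp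
      have "1 / \<beta> \<le> real (w p) / \<beta>" using p(2) \<beta> by (simp add: divide_right_mono)
      also have "\<dots> \<le> real (w p) / \<beta> + beta_proj \<beta> (tail_from (Suc p) w) / \<beta>"
        using \<beta> w by (simp add: beta_proj_nonneg[where M = \<beta>] tail_from_def)
      also have "\<dots> = beta_proj \<beta> (tail_from p w)"
        using \<beta> w beta_proj_split[of \<beta> "tail_from p w" \<beta> 1] by (simp add: tail_from_apply)
      finally have head: "1 / \<beta> \<le> beta_proj \<beta> (tail_from p w)" .
      have "beta_proj \<gamma> w \<le> digit_bound * (1 / \<gamma> ^ p)"
        using split[OF powr_base_gt_1(2)] proj_le_digit_bound[of "tail_from p w"] w \<beta> powr_base_gt_1(2)
        by (simp add: tail_from_apply divide_right_mono)
      also have "\<dots> \<le> digit_bound * (1 * (1 / \<beta> ^ p) powr \<theta>)"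
        using rate_less_1 D
        by (intro mult_left_mono order_trans[OF inverse_power_le] mult_right_mono power_le_one) auto
      also have "\<dots> = digit_bound * \<beta> * (1 / \<beta> * (1 / \<beta> ^ p) powr \<theta>)" using \<beta> by simp
      also have "\<dots> \<le> digit_bound * \<beta> * ((1 / \<beta>) powr \<theta> * (1 / \<beta> ^ p) powr \<theta>)"
      proof (intro mult_left_mono mult_right_mono)
        have "(1 / \<beta>) powr 1 \<le> (1 / \<beta>) powr \<theta>" using \<beta> \<theta> by (intro powr_mono') auto
        then show "1 / \<beta> \<le> (1 / \<beta>) powr \<theta>" using \<beta> by simp
      qed (use D \<beta> in auto)
      also have "(1 / \<beta>) powr \<theta> * (1 / \<beta> ^ p) powr \<theta> = (1 / \<beta> * (1 / \<beta> ^ p)) powr \<theta>"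
        by (rule powr_mult[symmetric])
      also have "digit_bound * \<beta> * (1 / \<beta> * (1 / \<beta> ^ p)) powr \<theta> \<le> digit_bound * \<beta> * beta_proj \<beta> w powr \<theta>"
      proof (intro mult_left_mono powr_mono2)
        show "1 / \<beta> * (1 / \<beta> ^ p) \<le> beta_proj \<beta> w"
          unfolding split[OF \<beta>] using divide_right_mono[OF head, of "\<beta> ^ p"] \<beta> by simp
      qed (use D \<beta> \<theta> in auto)
      finally show ?thesis using \<open>N = 0\<close> by simp
    qed
  qed
qed

text \<open>
  The fixed point of \<open>C \<mapsto> rate * (digit_bound * \<beta> + C)\<close>.
\<close>

definition "Holder_const = rate * (digit_bound * \<beta>) / (1 - rate)"

lemma Holder_const_pos: "0 < Holder_const"
  using rate_less_1 digit_bound_ge \<beta> by (simp add: Holder_const_def)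

text \<open>
  Let \<open>v\<close> and \<open>w\<close> first differ at digit \<open>k\<close>, let \<open>v'\<close> and \<open>w'\<close> be the tails behind it, and write
  \<open>\<pi>\<close> for the value in base \<open>\<beta>\<close> and \<open>e\<close> for the quasi-greedy sequence. Then
  \<open>\<beta> ^ Suc k * (\<pi> w - \<pi> v) = (w k - v k - 1 + \<pi> w') + (\<pi> e - \<pi> v')\<close>, with both brackets nonnegative.
  In base \<open>\<gamma>\<close> the value of \<open>e\<close> is at least \<open>1\<close>, so the same identity holds as an inequality in the useful
  direction. The first bracket is estimated directly; the second is a difference of the same kind
  for the pair \<open>v', e\<close>. Unfolding this \<open>r\<close> times leaves an error of order \<open>rate ^ r\<close>.
\<close>

lemma beta_proj_diff_le_approx:
  assumes "lex_le v w" "\<And>k. real (v k) \<le> \<beta>" "\<And>k. real (w k) \<le> \<beta>"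
    and "\<And>n. beta_proj \<beta> (tail_from n v) \<le> 1" "\<And>n. lex_le (tail_from n v) (quasi_greedy \<beta>)"
  shows "beta_proj \<gamma> w - beta_proj \<gamma> v
    \<le> Holder_const * (beta_proj \<beta> w - beta_proj \<beta> v) powr \<theta> + rate ^ r * digit_bound"
  using assms
proof (induction r arbitrary: v w)
  case 0
  have "0 \<le> beta_proj \<gamma> v" using powr_base_gt_1(2) "0.prems"(2) by (rule beta_proj_nonneg)
  moreover have "beta_proj \<gamma> w \<le> digit_bound" using proj_le_digit_bound[of w, OF "0.prems"(3)] \<beta> by linarith
  moreover have "0 \<le> Holder_const * (beta_proj \<beta> w - beta_proj \<beta> v) powr \<theta>"
    using Holder_const_pos by simp
  ultimately show ?case by simp
next
  case (Suc r)
  show ?case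
  proof (cases "v = w")
    case True
    then show ?thesis using rate_less_1 digit_bound_ge \<beta> by simp
  next
    case False
    then obtain k where k: "\<forall>j<k. v j = w j" "v k < w k" using Suc.prems(1) unfolding lex_le_def by blast
    define q where "q = Suc k"
    define N where "N = w k - v k - 1"
    define v' where "v' = tail_from q v"
    define w' where "w' = tail_from q w"
    define A where "A = real N + beta_proj \<beta> w'"
    define y where "y = 1 - beta_proj \<beta> v'"
    define D where "D = digit_bound"
    have N: "real N = real (w k) - real (v k) - 1" using k(2) by (simp add: N_def of_nat_diff)
    have N_le: "real N \<le> \<beta>" using N Suc.prems(3)[of k] by linarith
    have bounds: "\<And>k. real (v' k) \<le> \<beta>" "\<And>k. real (w' k) \<le> \<beta>"
      using Suc.prems(2,3) by (simp_all add: v'_def w'_def tail_from_apply)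
    have y: "0 \<le> y" using Suc.prems(4)[of q] by (simp add: y_def v'_def)
    have A: "0 \<le> A" using beta_proj_nonneg[OF \<beta> bounds(2)] by (simp add: A_def)
    have D: "0 \<le> D" using digit_bound_ge \<beta> by (simp add: D_def)
    have \<delta>: "beta_proj \<beta> w - beta_proj \<beta> v = (A + y) * (1 / \<beta> ^ q)"
      using beta_proj_diff[OF \<beta> Suc.prems(2,3) k(1)] N by (simp add: A_def y_def v'_def w'_def q_def)
    have greedy: "1 \<le> beta_proj \<gamma> (quasi_greedy \<beta>)"
    proof -
      have "beta_proj \<beta> (quasi_greedy \<beta>) \<le> beta_proj \<gamma> (quasi_greedy \<beta>)"
        using powr_base_gt_1(2) \<gamma>(2) quasi_greedy_le[OF \<beta>] by (rule beta_proj_base_antimono)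
      then show ?thesis using beta_proj_quasi_greedy[OF \<beta>] by simp
    qed
    have "beta_proj \<gamma> (quasi_greedy \<beta>) - beta_proj \<gamma> v'
        \<le> Holder_const * (beta_proj \<beta> (quasi_greedy \<beta>) - beta_proj \<beta> v') powr \<theta> + rate ^ r * digit_bound"
      using Suc.prems(4,5) bounds quasi_greedy_le[OF \<beta>] by (intro Suc.IH) (auto simp: v'_def)
    then have tail: "1 - beta_proj \<gamma> v' \<le> Holder_const * y powr \<theta> + rate ^ r * D"
      using greedy beta_proj_quasi_greedy[OF \<beta>] by (simp add: y_def D_def)
    have lead: "real N + beta_proj \<gamma> w' \<le> D * \<beta> * A powr \<theta>"
      unfolding A_def D_def using bounds(2) N_le by (rule leading_term_Holder)
    define Z where "Z = D * \<beta> * A powr \<theta> + Holder_const * y powr \<theta>"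
    have Z: "0 \<le> Z" using D \<beta> Holder_const_pos by (simp add: Z_def)
    have E: "0 \<le> rate ^ r * D" using D rate_less_1 by simp
    have "beta_proj \<gamma> w - beta_proj \<gamma> v = (real N + beta_proj \<gamma> w' + (1 - beta_proj \<gamma> v')) * (1 / \<gamma> ^ q)"
      using beta_proj_diff[OF powr_base_gt_1(2) Suc.prems(2,3) k(1)] N by (simp add: v'_def w'_def q_def)
    also have "\<dots> \<le> (Z + rate ^ r * D) * (1 / \<gamma> ^ q)"
      using lead tail powr_base_gt_1(2) unfolding Z_def by (intro mult_right_mono) auto
    also have "\<dots> \<le> (Z + rate ^ r * D) * (rate * (1 / \<beta> ^ q) powr \<theta>)"
    proof (intro mult_left_mono order_trans[OF inverse_power_le] mult_right_mono)
      show "rate ^ q \<le> rate" using rate_less_1 power_decreasing[of 1 q rate] by (simp add: q_def)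
    qed (use Z E in auto)
    also have "\<dots> = Z * rate * (1 / \<beta> ^ q) powr \<theta> + rate ^ Suc r * D * (1 / \<beta> ^ q) powr \<theta>"
      by (simp add: algebra_simps)
    also have "\<dots> \<le> Holder_const * (A + y) powr \<theta> * (1 / \<beta> ^ q) powr \<theta> + rate ^ Suc r * D * 1"
    proof (intro add_mono mult_right_mono mult_left_mono)
      have "Z \<le> D * \<beta> * (A + y) powr \<theta> + Holder_const * (A + y) powr \<theta>"
        unfolding Z_def using A y D \<beta> \<theta> Holder_const_pos by (intro add_mono mult_left_mono powr_mono2) auto
      then have "Z * rate \<le> (D * \<beta> + Holder_const) * rate * (A + y) powr \<theta>"
        using mult_right_mono[of Z _ rate] rate_less_1 by (fastforce simp: algebra_simps)
      also have "(D * \<beta> + Holder_const) * rate = Holder_const"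
        using rate_less_1 by (simp add: Holder_const_def D_def field_simps)
      finally show "Z * rate \<le> Holder_const * (A + y) powr \<theta>" .
      have "(1 / \<beta> ^ q) powr \<theta> \<le> 1 powr \<theta>" using \<beta> \<theta> by (intro powr_mono2) auto
      then show "(1 / \<beta> ^ q) powr \<theta> \<le> 1" by simp
    qed (use rate_less_1 D in auto)
    also have "\<dots> = Holder_const * (beta_proj \<beta> w - beta_proj \<beta> v) powr \<theta> + rate ^ Suc r * digit_bound"
      unfolding \<delta> using A y \<beta> by (subst powr_mult) (auto simp: D_def)
    finally show ?thesis .
  qed
qed

lemma beta_proj_diff_le:
  assumes "lex_le v w" "\<And>k. real (v k) \<le> \<beta>" "\<And>k. real (w k) \<le> \<beta>"
    and "\<And>n. beta_proj \<beta> (tail_from n v) \<le> 1" "\<And>n. lex_le (tail_from n v) (quasi_greedy \<beta>)"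
  shows "beta_proj \<gamma> w - beta_proj \<gamma> v \<le> Holder_const * (beta_proj \<beta> w - beta_proj \<beta> v) powr \<theta>"
proof (rule LIMSEQ_le_const)
  have "(\<lambda>r. rate ^ r) \<longlonglongrightarrow> 0" by (rule LIMSEQ_power_zero) (use rate_less_1 in simp)
  then have "(\<lambda>r. Holder_const * (beta_proj \<beta> w - beta_proj \<beta> v) powr \<theta> + rate ^ r * digit_bound)
      \<longlonglongrightarrow> Holder_const * (beta_proj \<beta> w - beta_proj \<beta> v) powr \<theta> + 0 * digit_bound"
    by (intro tendsto_add tendsto_mult tendsto_const)
  then show "(\<lambda>r. Holder_const * (beta_proj \<beta> w - beta_proj \<beta> v) powr \<theta> + rate ^ r * digit_bound)
      \<longlonglongrightarrow> Holder_const * (beta_proj \<beta> w - beta_proj \<beta> v) powr \<theta>" by simp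
  show "\<exists>N. \<forall>r\<ge>N. beta_proj \<gamma> w - beta_proj \<gamma> v
      \<le> Holder_const * (beta_proj \<beta> w - beta_proj \<beta> v) powr \<theta> + rate ^ r * digit_bound"
    using beta_proj_diff_le_approx[OF assms] by blast
qed

lemma beta_proj_Holder_lex:
  assumes v: "v \<in> beta_shift \<beta>" "v \<in> beta_shift \<gamma>" and w: "w \<in> beta_shift \<beta>" "w \<in> beta_shift \<gamma>"
    and lex: "lex_le v w"
  shows "\<bar>beta_proj \<gamma> w - beta_proj \<gamma> v\<bar> \<le> Holder_const * \<bar>beta_proj \<beta> w - beta_proj \<beta> v\<bar> powr \<theta>"
proof -
  note bounds = beta_shift_digit_le[OF \<beta> v(1)] beta_shift_digit_le[OF \<beta> w(1)]
  have "beta_proj \<gamma> v \<le> beta_proj \<gamma> w"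
    using powr_base_gt_1(2) bounds beta_shift_tail_proj_le_1[OF powr_base_gt_1(2) v(2)] lex
    by (rule beta_proj_mono_lex)
  moreover have "beta_proj \<beta> v \<le> beta_proj \<beta> w"
    using \<beta> bounds beta_shift_tail_proj_le_1[OF \<beta> v(1)] lex by (rule beta_proj_mono_lex)
  moreover have "beta_proj \<gamma> w - beta_proj \<gamma> v \<le> Holder_const * (beta_proj \<beta> w - beta_proj \<beta> v) powr \<theta>"
    using lex bounds beta_shift_tail_proj_le_1[OF \<beta> v(1)] beta_shift_tail_lex_le_quasi_greedy[OF \<beta> v(1)]
    by (rule beta_proj_diff_le)
  ultimately show ?thesis by simp
qed

end

lemma beta_proj_Holder:
  assumes \<beta>: "1 < \<beta>" and \<theta>: "0 < \<theta>" "\<theta> < \<theta>'" "\<theta>' \<le> 1"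
  obtains C where "0 < C"
    and "\<And>\<gamma> v w. \<beta> powr \<theta>' \<le> \<gamma> \<Longrightarrow> \<gamma> \<le> \<beta> \<Longrightarrow> v \<in> beta_shift \<beta> \<inter> beta_shift \<gamma> \<Longrightarrow> w \<in> beta_shift \<beta> \<inter> beta_shift \<gamma> \<Longrightarrow>
      dist (beta_proj \<gamma> v) (beta_proj \<gamma> w) \<le> C * dist (beta_proj \<beta> v) (beta_proj \<beta> w) powr \<theta>"
proof (rule that)
  have "\<beta> powr \<theta>' \<le> \<beta> powr 1" using \<beta> \<theta> by (intro powr_mono) auto
  then show "0 < Holder_const \<beta> \<theta> \<theta>'" using \<beta> by (intro Holder_const_pos[OF \<beta> \<theta>, of \<beta>]) auto
  fix \<gamma> v w
  assume \<gamma>: "\<beta> powr \<theta>' \<le> \<gamma>" "\<gamma> \<le> \<beta>" and vw: "v \<in> beta_shift \<beta> \<inter> beta_shift \<gamma>" "w \<in> beta_shift \<beta> \<inter> beta_shift \<gamma>"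
  show "dist (beta_proj \<gamma> v) (beta_proj \<gamma> w)
      \<le> Holder_const \<beta> \<theta> \<theta>' * dist (beta_proj \<beta> v) (beta_proj \<beta> w) powr \<theta>"
    using lex_le_linear[of v w]
      beta_proj_Holder_lex[OF \<beta> \<theta> \<gamma>, of v w] beta_proj_Holder_lex[OF \<beta> \<theta> \<gamma>, of w v] vw
    by (auto simp: dist_real_def abs_minus_commute)
qed

section \<open>Transfer to the larger base\<close>

text \<open>
  The base \<open>\<gamma> = \<beta>s n\<close> has to be chosen close to \<open>\<beta>\<close> depending on the interval, so close that a sequence
  with \<open>\<gamma>\<close>-value in the middle half of \<open>(a, b)\<close> has its \<open>\<beta>\<close>-value in \<open>(a, b)\<close>. The constant \<open>c\<close> survives
  because the Hoelder constant is the same for all these bases. Passing from \<open>\<gamma>\<close> to \<open>\<beta>\<close> replaces the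
  exponent \<open>t'\<close> by \<open>\<theta> * t' = t\<close>.
\<close>

lemma content_beta_proj_ge:
  fixes E :: "(nat \<Rightarrow> nat) set"
  assumes \<beta>: "1 < \<beta>" "\<And>n. \<beta>s n < \<beta>" "\<beta>s \<longlonglongrightarrow> \<beta>" and E: "E \<subseteq> beta_shift \<beta>"
    and large: "\<And>n. beta_proj (\<beta>s n) ` (E \<inter> beta_shift (\<beta>s n)) \<in> falconer_class_unit s"
    and t: "0 < t" "t < t'" "t' < s"
  obtains c where "0 < c" and "\<And>a b. 0 \<le> a \<Longrightarrow> a < b \<Longrightarrow> b \<le> 1 \<Longrightarrow>
    ennreal (c * (b - a) powr t') \<le> hausdorff_content t (beta_proj \<beta> ` E \<inter> {a<..<b})"
proof -
  \<comment> \<open>an exponent with \<open>\<theta> * t' = t\<close>, and room between \<open>\<theta>\<close> and \<open>1\<close> for \<open>\<theta>'\<close>\<close>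
  define \<theta> where "\<theta> = t / t'"
  define \<theta>' where "\<theta>' = (1 + \<theta>) / 2"
  have \<theta>: "0 < \<theta>" "\<theta> < \<theta>'" "\<theta>' \<le> 1" "\<theta>' < 1" and \<theta>_t': "\<theta> * t' = t"
    using t by (auto simp: \<theta>_def \<theta>'_def field_simps)
  obtain C where C: "0 < C"
    and Holder: "\<And>\<gamma> v w. \<beta> powr \<theta>' \<le> \<gamma> \<Longrightarrow> \<gamma> \<le> \<beta> \<Longrightarrow> v \<in> beta_shift \<beta> \<inter> beta_shift \<gamma> \<Longrightarrow> w \<in> beta_shift \<beta> \<inter> beta_shift \<gamma> \<Longrightarrow>
      dist (beta_proj \<gamma> v) (beta_proj \<gamma> w) \<le> C * dist (beta_proj \<beta> v) (beta_proj \<beta> w) powr \<theta>"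
    using beta_proj_Holder[OF \<beta>(1) \<theta>(1-3)] by blast
  show ?thesis
  proof (rule that[of "(1 / (2 * C)) powr t'"])
    show "0 < (1 / (2 * C)) powr t'" using C by simp
    fix a b :: real
    assume ab: "0 \<le> a" "a < b" "b \<le> 1"
    define h where "h = (b - a) / 4"
    have h: "0 < h" using ab by (simp add: h_def)
    have "\<beta> powr \<theta>' < \<beta> powr 1" using \<beta>(1) \<theta>(4) by (intro powr_less_mono) auto
    then have "eventually (\<lambda>n. \<beta> powr \<theta>' < \<beta>s n) sequentially"
      using \<beta> by (intro order_tendstoD(1)[OF \<beta>(3)]) auto
    moreover have "(\<lambda>n. \<beta> / (\<beta>s n - 1) - \<beta> / (\<beta> - 1)) \<longlonglongrightarrow> \<beta> / (\<beta> - 1) - \<beta> / (\<beta> - 1)"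
      using \<beta> by (intro tendsto_intros) auto
    then have "eventually (\<lambda>n. \<beta> / (\<beta>s n - 1) - \<beta> / (\<beta> - 1) < h) sequentially"
      using h by (intro order_tendstoD(2)) auto
    ultimately have "eventually (\<lambda>n. \<beta> powr \<theta>' < \<beta>s n \<and> \<beta> / (\<beta>s n - 1) - \<beta> / (\<beta> - 1) < h) sequentially"
      by (rule eventually_conj)
    then obtain n where n: "\<beta> powr \<theta>' < \<beta>s n" "\<beta> / (\<beta>s n - 1) - \<beta> / (\<beta> - 1) < h"
      using eventually_happens by force
    define \<gamma> where "\<gamma> = \<beta>s n"
    have \<gamma>: "\<beta> powr \<theta>' \<le> \<gamma>" "\<gamma> \<le> \<beta>" using n \<beta>(2)[of n] by (auto simp: \<gamma>_def)
    moreover have "1 < \<beta> powr \<theta>'" using \<beta>(1) \<theta> by (simp add: gr_one_powr)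
    ultimately have "1 < \<gamma>" by simp
    obtain F' where F': "F' \<in> falconer_class s" "beta_proj \<gamma> ` (E \<inter> beta_shift \<gamma>) = F' \<inter> {0..1}"
      using large[of n] unfolding falconer_class_unit_def \<gamma>_def by blast
    define T where "T = {w \<in> E \<inter> beta_shift \<gamma>. beta_proj \<beta> w \<in> {a<..<b}}"
    have sub: "F' \<inter> {a + h<..<b - h} \<subseteq> beta_proj \<gamma> ` T"
    proof
      fix y assume y: "y \<in> F' \<inter> {a + h<..<b - h}"
      then have "y \<in> F' \<inter> {0..1}" using ab h by auto
      then obtain w where w: "w \<in> E \<inter> beta_shift \<gamma>" "y = beta_proj \<gamma> w" using F'(2) by blast
      have "\<bar>beta_proj \<gamma> w - beta_proj \<beta> w\<bar> \<le> \<beta> / (\<gamma> - 1) - \<beta> / (\<beta> - 1)"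
        using \<open>1 < \<gamma>\<close> \<gamma>(2) by (rule abs_beta_proj_diff_base_le) (use beta_shift_digit_le[OF \<beta>(1)] w E in blast)
      then have "\<bar>y - beta_proj \<beta> w\<bar> < h" using n(2) w(2) by (simp add: \<gamma>_def)
      then have "beta_proj \<beta> w \<in> {a<..<b}" using y by auto
      then show "y \<in> beta_proj \<gamma> ` T" using w unfolding T_def by blast
    qed
    have "ennreal ((b - h - (a + h)) powr t') \<le> hausdorff_content t' (F' \<inter> {a + h<..<b - h})"
      using F'(1) t h ab by (intro falconer_class_content_ge) (auto simp: h_def field_simps)
    also have "\<dots> \<le> hausdorff_content t' (beta_proj \<gamma> ` T)"
      using sub by (rule hausdorff_content_mono)
    also have "\<dots> \<le> ennreal (C powr t') * hausdorff_content (\<theta> * t') (beta_proj \<beta> ` T)"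
      using Holder[OF \<gamma>] E C \<theta> t by (intro hausdorff_content_Holder) (auto simp: T_def)
    also have "\<dots> \<le> ennreal (C powr t') * hausdorff_content t (beta_proj \<beta> ` E \<inter> {a<..<b})"
      unfolding \<theta>_t' by (intro mult_left_mono hausdorff_content_mono) (auto simp: T_def)
    finally have "ennreal ((1 / C) powr t') * ennreal ((b - h - (a + h)) powr t')
        \<le> ennreal ((1 / C) powr t') * (ennreal (C powr t') * hausdorff_content t (beta_proj \<beta> ` E \<inter> {a<..<b}))"
      by (intro mult_left_mono) auto
    also have "\<dots> = hausdorff_content t (beta_proj \<beta> ` E \<inter> {a<..<b})"
    proof -
      have "ennreal ((1 / C) powr t') * ennreal (C powr t') = 1"
        using C by (simp flip: ennreal_mult powr_mult)
      then show ?thesis by (simp only: mult.assoc[symmetric] mult_1)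
    qed
    also have "ennreal ((1 / C) powr t') * ennreal ((b - h - (a + h)) powr t')
        = ennreal ((1 / (2 * C)) powr t' * (b - a) powr t')"
    proof -
      have "1 / C * (b - h - (a + h)) = 1 / (2 * C) * (b - a)"
        using C by (simp add: h_def field_simps)
      then show ?thesis by (simp flip: ennreal_mult powr_mult)
    qed
    finally show "ennreal ((1 / (2 * C)) powr t' * (b - a) powr t')
        \<le> hausdorff_content t (beta_proj \<beta> ` E \<inter> {a<..<b})" .
  qed
qed

text \<open>
  One of the three thirds of an interval lies inside or outside the unit interval: the first lies to the
  left of \<open>0\<close>, or the last to the right of \<open>1\<close>, or else the middle one lies in \<open>[0, 1]\<close>.
\<close>

lemma locally_large_Un_Compl_unit:
  assumes c: "0 < c" and t: "0 < t" "t \<le> e" "e < 1"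
    and inner: "\<And>a b. 0 \<le> a \<Longrightarrow> a < b \<Longrightarrow> b \<le> 1 \<Longrightarrow> ennreal (c * (b - a) powr e) \<le> hausdorff_content t (F \<inter> {a<..<b})"
    and line: "\<And>a b. a < b \<Longrightarrow> ennreal ((b - a) powr t) \<le> hausdorff_content t {a<..<b}"
  shows "locally_large t (F \<union> - {0..1})"
proof -
  define c' where "c' = min c 1 * (1 / 3) powr e"
  have "ennreal (c' * (b - a) powr e) \<le> hausdorff_content t ((F \<union> - {0..1}) \<inter> {a<..<b})"
    if ab: "a < b" "b - a \<le> 1" for a b
  proof -
    define h where "h = (b - a) / 3"
    have h: "0 < h" "h \<le> 1" using ab by (auto simp: h_def)
    have c'_h: "c' * (b - a) powr e = min c 1 * h powr e"
      using powr_mult[of "1 / 3" "b - a" e] by (simp add: c'_def h_def mult.assoc)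
    have inner_part: ?thesis if "0 \<le> a'" "b' \<le> 1" "b' - a' = h" "a \<le> a'" "b' \<le> b" for a' b'
    proof -
      have "ennreal (c' * (b - a) powr e) \<le> ennreal (c * (b' - a') powr e)"
        unfolding c'_h that(3) by (intro ennreal_leI mult_right_mono) auto
      also have "\<dots> \<le> hausdorff_content t (F \<inter> {a'<..<b'})" using that h by (intro inner) auto
      also have "\<dots> \<le> hausdorff_content t ((F \<union> - {0..1}) \<inter> {a<..<b})"
        using that by (intro hausdorff_content_mono) auto
      finally show ?thesis .
    qed
    have outer_part: ?thesis if "b' \<le> 0 \<or> 1 \<le> a'" "b' - a' = h" "a \<le> a'" "b' \<le> b" for a' b'
    proof -
      have "min c 1 * h powr e \<le> 1 * h powr t"
        using c h t by (intro mult_mono powr_mono') auto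
      then have "ennreal (c' * (b - a) powr e) \<le> ennreal ((b' - a') powr t)"
        unfolding c'_h that(2) by (intro ennreal_leI) simp
      also have "\<dots> \<le> hausdorff_content t {a'<..<b'}" using that h by (intro line) auto
      also have "\<dots> \<le> hausdorff_content t ((F \<union> - {0..1}) \<inter> {a<..<b})"
        using that by (intro hausdorff_content_mono) auto
      finally show ?thesis .
    qed
    consider "a + h \<le> 0" | "1 \<le> b - h" | "0 \<le> a + h" "b - h \<le> 1" by linarith
    then show ?thesis
    proof cases
      case 1
      then show ?thesis using ab h by (intro outer_part[of "a + h" a]) (auto simp: h_def field_simps)
    next
      case 2
      then show ?thesis using ab h by (intro outer_part[of b "b - h"]) (auto simp: h_def field_simps)
    next
      case 3
      then show ?thesis using ab h by (intro inner_part[of "a + h" "b - h"]) (auto simp: h_def field_simps)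
    qed
  qed
  moreover have "0 < c'" using c by (simp add: c'_def)
  ultimately show ?thesis
    unfolding locally_large_def using t(3) by (intro exI[of _ c'] exI[of _ e] exI[of _ 1] conjI) auto
qed

theorem theorem2:
  fixes s \<beta> :: real and \<beta>s :: "nat \<Rightarrow> real" and E :: "(nat \<Rightarrow> nat) set" and F :: "real set"
  assumes "0 < s" and "s \<le> 1"
    and "1 < \<beta>"
    and "\<And>n. 1 < \<beta>s n" and "\<And>n. \<beta>s n < \<beta>"
    and "\<beta>s \<longlonglongrightarrow> \<beta>"
    and "E \<subseteq> beta_shift \<beta>"
    and "\<And>n. beta_proj (\<beta>s n) ` (E \<inter> beta_shift (\<beta>s n)) \<in> falconer_class_unit s"
    and "F \<subseteq> {0..1}" and "gdelta_in euclidean F"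
    and "beta_proj \<beta> ` E \<subseteq> F"
  shows "F \<in> falconer_class_unit s"
proof -
  have "F \<union> - {0..1} \<in> falconer_class s"
  proof (rule falconer_classI)
    show "gdelta_in euclidean (F \<union> - {0..1})"
      by (rule gdelta_in_Un[OF assms(10)], rule open_imp_gdelta_in) (auto simp: open_Compl)
    show "s \<le> 1" by fact
    fix t assume t: "0 < t" "t < s"
    define t' where "t' = (t + s) / 2"
    have t': "t < t'" "t' < s" using t by (auto simp: t'_def)
    obtain c where c: "0 < c" "\<And>a b. 0 \<le> a \<Longrightarrow> a < b \<Longrightarrow> b \<le> 1 \<Longrightarrow>
        ennreal (c * (b - a) powr t') \<le> hausdorff_content t (beta_proj \<beta> ` E \<inter> {a<..<b})"
      using content_beta_proj_ge[OF assms(3,5,6,7,8) t(1) t'] by blast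
    \<comment> \<open>any member of the class bounds the content of an interval from below\<close>
    obtain F' where F': "F' \<in> falconer_class s"
      using assms(8) unfolding falconer_class_unit_def by blast
    show "locally_large t (F \<union> - {0..1})"
    proof (rule locally_large_Un_Compl_unit[where e = t'])
      fix a b :: real assume "a < b"
      have "ennreal ((b - a) powr t) \<le> hausdorff_content t (F' \<inter> {a<..<b})"
        using F' t \<open>a < b\<close> by (rule falconer_class_content_ge)
      also have "\<dots> \<le> hausdorff_content t {a<..<b}" by (intro hausdorff_content_mono) auto
      finally show "ennreal ((b - a) powr t) \<le> hausdorff_content t {a<..<b}" .
    next
      fix a b :: real assume ab: "0 \<le> a" "a < b" "b \<le> 1"
      have "ennreal (c * (b - a) powr t') \<le> hausdorff_content t (beta_proj \<beta> ` E \<inter> {a<..<b})"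
        using ab by (rule c(2))
      also have "\<dots> \<le> hausdorff_content t (F \<inter> {a<..<b})"
        using assms(11) by (intro hausdorff_content_mono) blast
      finally show "ennreal (c * (b - a) powr t') \<le> hausdorff_content t (F \<inter> {a<..<b})" .
    qed (use c t t' assms(2) in auto)
  qed
  moreover have "F = (F \<union> - {0..1}) \<inter> {0..1}" using assms(9) by blast
  ultimately show ?thesis unfolding falconer_class_unit_def by blast
qed

end
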